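(* Let $\kappa$ be a cardinal with $\omega_{1}\leq\kappa\leq\mathfrak c$ and $\mathrm{cf}(\kappa)>\omega$. Then $\omega^{*}\rightarrow(P_{\kappa})^{1}_{2}$.
   Context: $\mathfrak c=2^{\aleph_0}$. $\omega$ is the countably infinite discrete space, $\beta(\omega)$ its Stone-Čech compactification, and $\omega^{*}=\beta(\omega)\setminus\omega$ with the subspace topology. For an infinite cardinal $\kappa$, $P_\kappa$ is the set $\kappa+1=\kappa\cup\{\kappa\}$ with the topology in which $U\subseteq\kappa+1$ is open if and only if either $U\subseteq\kappa$ or there is $\xi<\kappa$ with $(\xi,\kappa]\subseteq U$. For topological spaces $X,Y$, the relation $X\rightarrow(Y)^{1}_{2}$ means: whenever $X=P_0\cup P_1$, there are $i\in\{0,1\}$ and $Y'\subseteq P_i$ such that $Y'$ (with the subspace topology from $X$) is homeomorphic to $Y$. *)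

theory Defs
  imports "HOL-Analysis.Analysis"
begin

unbundle cardinal_syntax

text \<open>
  The Stone-Cech compactification of a (Tychonoff) space \<open>X\<close> is the closure of the image of \<open>X\<close>
  under the evaluation map into the Tychonoff cube whose factors \<open>[0,1]\<close> are indexed by the
  continuous functions from \<open>X\<close> to \<open>[0,1]\<close>. Index functions are taken extensional on
  \<open>topspace X\<close> so that each of them is counted once.
\<close>

definition unit_maps :: "'a topology \<Rightarrow> ('a \<Rightarrow> real) set" where
  "unit_maps X = {f \<in> extensional (topspace X). continuous_map X (top_of_set {0..1}) f}"

definition tychonoff_cube :: "'a topology \<Rightarrow> (('a \<Rightarrow> real) \<Rightarrow> real) topology" where
  "tychonoff_cube X = product_topology (\<lambda>_. top_of_set {0..1}) (unit_maps X)"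

definition stone_cech_map :: "'a topology \<Rightarrow> 'a \<Rightarrow> (('a \<Rightarrow> real) \<Rightarrow> real)" where
  "stone_cech_map X x = (\<lambda>f\<in>unit_maps X. f x)"

definition stone_cech :: "'a topology \<Rightarrow> (('a \<Rightarrow> real) \<Rightarrow> real) topology" where
  "stone_cech X =
     subtopology (tychonoff_cube X) (tychonoff_cube X closure_of (stone_cech_map X ` topspace X))"

definition stone_cech_remainder :: "'a topology \<Rightarrow> (('a \<Rightarrow> real) \<Rightarrow> real) topology" where
  "stone_cech_remainder X =
     subtopology (stone_cech X) (topspace (stone_cech X) - stone_cech_map X ` topspace X)"

abbreviation omega_star :: "((nat \<Rightarrow> real) \<Rightarrow> real) topology" where
  "omega_star \<equiv> stone_cech_remainder (discrete_topology (UNIV :: nat set))"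

lemma stone_cech_embedding:
  assumes "completely_regular_space X" "Hausdorff_space X"
  shows "embedding_map X (tychonoff_cube X) (stone_cech_map X)"
proof -
  have "mspace (submetric (cfunspace X euclidean_metric) {f. f \<in> topspace X \<rightarrow> {0..1}})
          = unit_maps X"
    by (auto simp: unit_maps_def continuous_map_in_subtopology image_subset_iff_funcset
        intro: bounded_subset[OF bounded_closed_interval[of 0 1]])
  then show ?thesis
    using completely_regular_space_cube_embedding_explicit[OF assms]
    by (simp add: tychonoff_cube_def stone_cech_map_def[abs_def])
qed

text \<open>
  The space \<open>P\<^sub>\<kappa>\<close>: cardinals are relations \<open>\<kappa>\<close> with \<open>Card_order \<kappa>\<close>, so the ordinals below
  \<open>\<kappa>\<close> are the elements of \<open>Field \<kappa>\<close>, ordered by \<open>\<kappa>\<close>. The ordinal \<open>\<xi> < \<kappa>\<close> is the point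
  \<open>Some \<xi>\<close>, and \<open>None\<close> is the additional top point \<open>\<kappa>\<close>.
\<close>

definition P_points :: "'k rel \<Rightarrow> 'k option set" where
  "P_points \<kappa> = insert None (Some ` Field \<kappa>)"

text \<open>The interval \<open>(\<xi>, \<kappa>]\<close>; \<open>aboveS \<kappa> \<xi>\<close> is the set of all \<open>\<eta> \<in> Field \<kappa>\<close> strictly above \<open>\<xi>\<close>.\<close>

definition P_tail :: "'k rel \<Rightarrow> 'k \<Rightarrow> 'k option set" where
  "P_tail \<kappa> \<xi> = insert None (Some ` aboveS \<kappa> \<xi>)"

definition P_open :: "'k rel \<Rightarrow> 'k option set \<Rightarrow> bool" where
  "P_open \<kappa> U \<longleftrightarrow>
     U \<subseteq> P_points \<kappa> \<and> (U \<subseteq> Some ` Field \<kappa> \<or> (\<exists>\<xi>\<in>Field \<kappa>. P_tail \<kappa> \<xi> \<subseteq> U))"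

definition P_space :: "'k rel \<Rightarrow> 'k option topology" where
  "P_space \<kappa> = topology (P_open \<kappa>)"

lemma istopology_P_open:
  assumes "Card_order \<kappa>"
  shows "istopology (P_open \<kappa>)"
proof -
  have lin: "Linear_order \<kappa>"
    using assms by (simp add: card_order_on_def well_order_on_def)
  have tail: "P_tail \<kappa> \<eta> \<subseteq> P_tail \<kappa> \<xi>" if "(\<xi>, \<eta>) \<in> \<kappa>" for \<xi> \<eta>
    using that lin
    unfolding P_tail_def aboveS_def linear_order_on_def partial_order_on_def preorder_on_def
    by (auto dest: transD antisymD)
  have total: "(\<xi>, \<eta>) \<in> \<kappa> \<or> (\<eta>, \<xi>) \<in> \<kappa>" if "\<xi> \<in> Field \<kappa>" "\<eta> \<in> Field \<kappa>" for \<xi> \<eta>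
    using that lin
    unfolding linear_order_on_def partial_order_on_def preorder_on_def total_on_def refl_on_def
    by metis
  show ?thesis
    unfolding istopology_def
  proof (intro conjI allI impI)
    fix S T
    assume S: "P_open \<kappa> S" and T: "P_open \<kappa> T"
    show "P_open \<kappa> (S \<inter> T)"
    proof (cases "S \<subseteq> Some ` Field \<kappa> \<or> T \<subseteq> Some ` Field \<kappa>")
      case True
      then show ?thesis
        using S T unfolding P_open_def by blast
    next
      case False
      then obtain \<xi> \<eta> where x: "\<xi> \<in> Field \<kappa>" "P_tail \<kappa> \<xi> \<subseteq> S"
        and y: "\<eta> \<in> Field \<kappa>" "P_tail \<kappa> \<eta> \<subseteq> T"
        using S T unfolding P_open_def by blast
      have "\<exists>\<zeta>\<in>Field \<kappa>. P_tail \<kappa> \<zeta> \<subseteq> S \<inter> T"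
        using total[OF x(1) y(1)]
      proof
        assume "(\<xi>, \<eta>) \<in> \<kappa>"
        then show ?thesis using tail x y by blast
      next
        assume "(\<eta>, \<xi>) \<in> \<kappa>"
        then show ?thesis using tail x y by blast
      qed
      then show ?thesis
        using S unfolding P_open_def by blast
    qed
  next
    fix \<K>
    assume K: "\<forall>K\<in>\<K>. P_open \<kappa> K"
    show "P_open \<kappa> (\<Union>\<K>)"
    proof (cases "\<forall>K\<in>\<K>. K \<subseteq> Some ` Field \<kappa>")
      case True
      then have "\<Union>\<K> \<subseteq> Some ` Field \<kappa>"
        by blast
      then show ?thesis
        unfolding P_open_def P_points_def by blast
    next
      case False
      then obtain K where "K \<in> \<K>" "\<not> K \<subseteq> Some ` Field \<kappa>"
        by blast
      with K obtain \<xi> where "\<xi> \<in> Field \<kappa>" "P_tail \<kappa> \<xi> \<subseteq> K"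
        unfolding P_open_def by blast
      with \<open>K \<in> \<K>\<close> have "\<exists>\<xi>\<in>Field \<kappa>. P_tail \<kappa> \<xi> \<subseteq> \<Union>\<K>"
        by blast
      moreover have "\<Union>\<K> \<subseteq> P_points \<kappa>"
        using K unfolding P_open_def by blast
      ultimately show ?thesis
        unfolding P_open_def by blast
    qed
  qed
qed

lemma openin_P_space: "Card_order \<kappa> \<Longrightarrow> openin (P_space \<kappa>) U \<longleftrightarrow> P_open \<kappa> U"
  by (simp add: P_space_def istopology_P_open topology_inverse')

text \<open>
  The cofinality of an infinite cardinal: the least cardinality of a cofinal subset. The library's
  \<open>cofinal\<close> asks for strict upper bounds, which makes no difference here since infinite cardinals
  are limit ordinals.
\<close>

definition cofinality :: "'k rel \<Rightarrow> 'k rel" where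
  "cofinality \<kappa> = |SOME A. A \<subseteq> Field \<kappa> \<and> cofinal A \<kappa> \<and>
                         (\<forall>B. B \<subseteq> Field \<kappa> \<and> cofinal B \<kappa> \<longrightarrow> |A| \<le>o |B| )|"

lemma cofinality_least:
  assumes "B \<subseteq> Field \<kappa>" "cofinal B \<kappa>"
  shows "\<exists>A. A \<subseteq> Field \<kappa> \<and> cofinal A \<kappa> \<and> cofinality \<kappa> = |A|" and "cofinality \<kappa> \<le>o |B|"
proof -
  let ?P = "\<lambda>A. A \<subseteq> Field \<kappa> \<and> cofinal A \<kappa> \<and>
              (\<forall>B. B \<subseteq> Field \<kappa> \<and> cofinal B \<kappa> \<longrightarrow> |A| \<le>o |B| )"
  let ?R = "card_of ` {A. A \<subseteq> Field \<kappa> \<and> cofinal A \<kappa>}"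
  have "\<exists>r\<in>?R. \<forall>r'\<in>?R. r \<le>o r'"
    using assms by (intro exists_minim_Card_order) (auto simp: card_of_Card_order)
  then have "\<exists>A. ?P A"
    by blast
  then have "?P (SOME A. ?P A)"
    by (rule someI_ex)
  then show "\<exists>A. A \<subseteq> Field \<kappa> \<and> cofinal A \<kappa> \<and> cofinality \<kappa> = |A|" "cofinality \<kappa> \<le>o |B|"
    using assms unfolding cofinality_def by blast+
qed

definition top_arrow :: "'a topology \<Rightarrow> 'b topology \<Rightarrow> bool" where
  "top_arrow X Y \<longleftrightarrow>
     (\<forall>P :: nat \<Rightarrow> 'a set. topspace X = P 0 \<union> P 1 \<longrightarrow>
        (\<exists>i\<in>{0, 1}. \<exists>Y'. Y' \<subseteq> P i \<and> subtopology X Y' homeomorphic_space Y))"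

end

theory Submission
  imports Defs
begin

text \<open>
  Let \<open>I\<close> be a set of size continuum. An independent family indexed by \<open>I\<close> is a map \<open>\<phi>\<close> from
  \<open>\<omega>\<close> to the cube \<open>2\<^sup>I\<close> with dense image. A filter on \<open>\<omega>\<close> that is maximal among those along which
  \<open>\<phi>\<close> stays dense decides every set of integers on a dense open subset of the cube, and each such
  decision depends on countably many coordinates only. Fix an ultrafilter \<open>\<U>\<close> on the cube that
  contains all neighbourhoods of the origin and all dense open sets. Translating \<open>\<U>\<close> by \<open>z\<close> and
  pulling back the decisions gives a free ultrafilter \<open>u z\<close> on \<open>\<omega>\<close> lying over \<open>z\<close>, and whether a
  given set belongs to \<open>u z\<close> depends on countably many coordinates of \<open>z\<close> only. Hence \<open>u\<close> embeds
  into \<open>\<omega>\<^sup>*\<close> every subspace of the cube in which countable intersections of open sets are open;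
  as \<open>cf(\<kappa>) > \<omega>\<close>, this applies to \<open>P\<^sub>\<kappa> \<times> P\<^sub>\<kappa>\<close>.

  Now let the corner \<open>(\<kappa>, \<kappa>)\<close> have colour \<open>i\<close>. If \<open>\<kappa>\<close> many \<open>(\<xi>, \<kappa>)\<close> have colour \<open>i\<close>, they
  form a copy of \<open>P\<^sub>\<kappa>\<close> together with the corner. Otherwise \<open>\<kappa>\<close> many have the other colour; either
  one of them is the limit of \<open>\<kappa>\<close> many \<open>(\<xi>, \<eta>)\<close> of its own colour, or for each of them there is
  \<open>\<eta> > \<xi>\<close> such that \<open>(\<xi>, \<eta>)\<close> has colour \<open>i\<close>, and these points converge to the corner.
\<close>

section \<open>Ultrafilters over the points of a Cantor cube\<close>

text \<open>For finite \<open>N\<close> the \<open>x\<close> with \<open>agree_on N x y\<close> form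
  a basic open set of the cube; for countable \<open>N\<close> they form a basic open set of a finer
  topology, in which countable intersections of open sets are open.\<close>

definition agree_on :: "'i set \<Rightarrow> ('i \<Rightarrow> 'b) \<Rightarrow> ('i \<Rightarrow> 'b) \<Rightarrow> bool" where
  "agree_on N x y \<longleftrightarrow> (\<forall>i\<in>N. x i = y i)"

lemma agree_onI: "(\<And>i. i \<in> N \<Longrightarrow> x i = y i) \<Longrightarrow> agree_on N x y"
  by (simp add: agree_on_def)

definition ultra :: "'a filter \<Rightarrow> bool" where
  "ultra u \<longleftrightarrow> u \<noteq> bot \<and> (\<forall>P. eventually P u \<or> eventually (\<lambda>x. \<not> P x) u)"

section \<open>Minimal filters and ultrafilters\<close>

text \<open>Zorn's lemma for the reversed order: what holds eventually along the infimum of a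
  nonempty chain already holds eventually along a member, so no \<open>P\<close> in
  \<open>\<P>\<close> is lost in the limit. Used with one constant predicate to get ultrafilters,
  and with the basic open sets of the cube to get a deciding filter.\<close>

lemma exists_minimal_filter:
  assumes "\<And>P. P \<in> \<P> \<Longrightarrow> frequently P F0"
  shows "\<exists>F\<le>F0. (\<forall>P\<in>\<P>. frequently P F) \<and>
           (\<forall>F'\<le>F. (\<forall>P\<in>\<P>. frequently P F') \<longrightarrow> F' = F)"
proof -
  define \<A> where "\<A> = {F. F \<le> F0 \<and> (\<forall>P\<in>\<P>. frequently P F)}"
  have "\<exists>m\<in>\<A>. \<forall>a\<in>\<A>. m \<ge> a \<longrightarrow> a = m"
  proof (rule predicate_Zorn)
    show "partial_order_on \<A> (relation_of (\<lambda>x y. x \<ge> y) \<A>)"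
      by (rule partial_order_on_relation_ofI) auto
    fix C assume C: "C \<in> Chains (relation_of (\<lambda>x y. x \<ge> y) \<A>)"
    then have CA: "C \<subseteq> \<A>"
      by (rule Chains_relation_of)
    show "\<exists>u\<in>\<A>. \<forall>a\<in>C. a \<ge> u"
    proof (cases "C = {}")
      case True
      have "F0 \<in> \<A>"
        using assms by (simp add: \<A>_def)
      then show ?thesis
        using True by blast
    next
      case False
      have ev: "eventually P (Inf C) \<longleftrightarrow> (\<exists>F\<in>C. eventually P F)" for P
        using C False
        by (intro eventually_Inf_base) (auto simp: Chains_def relation_of_def)
      have "frequently P (Inf C)" if "P \<in> \<P>" for P
        using that CA unfolding frequently_def ev \<A>_def by (auto simp: frequently_def)
      moreover have "Inf C \<le> F0"
        using False CA by (auto simp: \<A>_def intro: Inf_lower2)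
      ultimately show ?thesis
        by (auto simp: \<A>_def intro: Inf_lower)
    qed
  qed
  then show ?thesis
    unfolding \<A>_def by (auto intro: order_trans)
qed

text \<open>A minimal proper filter decides every \<open>P\<close>: otherwise restricting it to
  \<open>P\<close> would give a strictly smaller proper filter.\<close>

lemma exists_ultra_le:
  assumes "F \<noteq> bot"
  shows "\<exists>u\<le>F. ultra u"
proof -
  \<comment> \<open>For a constantly true predicate, \<open>frequently\<close> just says that the
    filter is proper.\<close>
  obtain u where u: "u \<le> F" "u \<noteq> bot" and min: "\<And>F'. F' \<le> u \<Longrightarrow> F' \<noteq> bot \<Longrightarrow> F' = u"
    using exists_minimal_filter[of "{\<lambda>_. True}" F] assms
    by (auto simp: frequently_def trivial_limit_def)
  have "eventually P u \<or> eventually (\<lambda>x. \<not> P x) u" for P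
  proof (rule ccontr)
    assume neg: "\<not> (eventually P u \<or> eventually (\<lambda>x. \<not> P x) u)"
    have "inf u (principal {x. P x}) \<noteq> bot"
      using neg by (simp add: trivial_limit_def eventually_inf_principal)
    then have "inf u (principal {x. P x}) = u"
      by (intro min) auto
    then have "u \<le> principal {x. P x}"
      by (metis inf.cobounded2)
    then show False
      using neg by (simp add: le_principal)
  qed
  with u show ?thesis
    unfolding ultra_def by blast
qed

lemma ultra_not_eventually: "ultra u \<Longrightarrow> (\<not> eventually P u) \<longleftrightarrow> eventually (\<lambda>x. \<not> P x) u"
  using eventually_conj[of P u "\<lambda>x. \<not> P x"] by (auto simp: ultra_def trivial_limit_def)

text \<open>By compactness the image filter has a cluster point; along an ultrafilter a cluster
  point is a limit.\<close>

lemma ultra_tendsto_in_compact: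
  fixes f :: "'a \<Rightarrow> 'b::topological_space"
  assumes "ultra u" "compact K" "\<And>x. f x \<in> K"
  shows "\<exists>l\<in>K. (f \<longlongrightarrow> l) u"
proof -
  have "filtermap f u \<noteq> bot"
    using assms(1) by (simp add: ultra_def filtermap_bot_iff)
  then obtain l where l: "l \<in> K" "inf (nhds l) (filtermap f u) \<noteq> bot"
    using assms(2,3) unfolding compact_filter by (metis (mono_tags) eventually_filtermap always_eventually)
  have "eventually (\<lambda>x. f x \<in> S) u" if S: "open S" "l \<in> S" for S
  proof (rule ccontr)
    assume "\<not> eventually (\<lambda>x. f x \<in> S) u"
    then have "eventually (\<lambda>y. y \<notin> S) (filtermap f u)"
      using assms(1) by (simp add: ultra_not_eventually eventually_filtermap)
    moreover have "eventually (\<lambda>y. y \<in> S) (nhds l)"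
      using S eventually_nhds by blast
    ultimately have "eventually (\<lambda>_. False) (inf (nhds l) (filtermap f u))"
      unfolding eventually_inf by blast
    then show False
      using l(2) by (simp add: trivial_limit_def)
  qed
  then show ?thesis
    using l(1) by (auto simp: tendsto_def)
qed

section \<open>Finite conditions deciding sets\<close>

text \<open>Terminology of Cohen forcing: for finite \<open>N\<close> the restriction of
  \<open>s\<close> to \<open>N\<close> is a condition. Density of \<open>\<phi>\<close> along
  \<open>F\<close> means that no condition forces a contradiction.\<close>

definition forces :: "('a \<Rightarrow> 'i \<Rightarrow> bool) \<Rightarrow> 'a filter \<Rightarrow> 'i set \<Rightarrow> ('i \<Rightarrow> bool) \<Rightarrow> ('a \<Rightarrow> bool) \<Rightarrow> bool" where
  "forces \<phi> F N s P \<longleftrightarrow> (\<forall>\<^sub>F n in F. agree_on N (\<phi> n) s \<longrightarrow> P n)"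

definition dense_along :: "('a \<Rightarrow> 'i \<Rightarrow> bool) \<Rightarrow> 'a filter \<Rightarrow> bool" where
  "dense_along \<phi> F \<longleftrightarrow> (\<forall>N s. finite N \<longrightarrow> (\<exists>\<^sub>F n in F. agree_on N (\<phi> n) s))"

lemma forces_cong: "agree_on N s t \<Longrightarrow> forces \<phi> F N s P \<longleftrightarrow> forces \<phi> F N t P"
  unfolding forces_def agree_on_def by auto

lemma forces_conj:
  assumes "forces \<phi> F N s P" "forces \<phi> F M s Q"
  shows "forces \<phi> F (N \<union> M) s (\<lambda>n. P n \<and> Q n)"
  using assms unfolding forces_def by eventually_elim (auto simp: agree_on_def)

lemma forces_False:
  assumes "dense_along \<phi> F" "finite N"
  shows "\<not> forces \<phi> F N s (\<lambda>_. False)"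
  using assms unfolding forces_def dense_along_def frequently_def by simp

lemma forces_contradiction:
  assumes "dense_along \<phi> F" "finite N" "finite M" "forces \<phi> F N s P" "forces \<phi> F M s (\<lambda>n. \<not> P n)"
  shows False
  using forces_conj[OF assms(4,5)] forces_False[of \<phi> F "N \<union> M" s] assms(1-3) by simp

text \<open>Take \<open>F\<close> minimal among the filters below \<open>F0\<close> that keep
  \<open>\<phi>\<close> dense. If no extension of a condition decided \<open>P\<close>, then
  restricting \<open>F\<close> to the set where the condition implies \<open>P\<close> would keep
  density, so by minimality the condition would already force \<open>P\<close>.\<close>

lemma exists_deciding_filter:
  assumes "dense_along \<phi> F0"
  shows "\<exists>F\<le>F0. dense_along \<phi> F \<and> (\<forall>P N s. finite N \<longrightarrow>
           (\<exists>M t. finite M \<and> N \<subseteq> M \<and> agree_on N s t \<and>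
              (forces \<phi> F M t P \<or> forces \<phi> F M t (\<lambda>n. \<not> P n))))"
proof -
  define \<P> where "\<P> = {\<lambda>n. agree_on N (\<phi> n) s | N s. finite N}"
  have dense: "dense_along \<phi> F \<longleftrightarrow> (\<forall>P\<in>\<P>. frequently P F)" for F
    unfolding dense_along_def \<P>_def by blast
  obtain F where F: "F \<le> F0" "dense_along \<phi> F"
    and min: "\<And>F'. F' \<le> F \<Longrightarrow> dense_along \<phi> F' \<Longrightarrow> F' = F"
    using exists_minimal_filter[of \<P> F0] assms unfolding dense by metis
  have "\<exists>M t. finite M \<and> N \<subseteq> M \<and> agree_on N s t \<and>
              (forces \<phi> F M t P \<or> forces \<phi> F M t (\<lambda>n. \<not> P n))" if N: "finite N" for N s P
  proof (rule ccontr)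
    assume "\<not> ?thesis"
    then have und: "\<not> forces \<phi> F M t P" "\<not> forces \<phi> F M t (\<lambda>n. \<not> P n)"
      if "finite M" "N \<subseteq> M" "agree_on N s t" for M t
      using that by blast+
    define F' where "F' = inf F (principal {n. agree_on N (\<phi> n) s \<longrightarrow> P n})"
    have "\<exists>\<^sub>F n in F'. agree_on M (\<phi> n) t" if M: "finite M" for M t
    proof (cases "agree_on (N \<inter> M) s t")
      case True
      \<comment> \<open>A common extension of the two compatible conditions. It does not force
        \<open>\<not> P\<close>, so \<open>\<phi>\<close> still meets it inside
        \<open>P\<close>.\<close>
      define w where "w = (\<lambda>i. if i \<in> N then s i else t i)"
      have "\<not> forces \<phi> F (N \<union> M) w (\<lambda>n. \<not> P n)"
        using N M by (intro und(2)) (auto simp: w_def agree_on_def)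
      then have "\<exists>\<^sub>F n in F. agree_on (N \<union> M) (\<phi> n) w \<and> P n"
        by (simp add: forces_def frequently_def)
      then show ?thesis
        unfolding F'_def frequently_def eventually_inf_principal
        by (rule contrapos_nn) (use True in \<open>auto elim!: eventually_mono simp: w_def agree_on_def split: if_splits\<close>)
    next
      \<comment> \<open>A point agreeing with \<open>t\<close> on \<open>M\<close> now violates
        \<open>s\<close> on \<open>N\<close>, so the added implication holds there
        vacuously.\<close>
      case False
      have "\<exists>\<^sub>F n in F. agree_on M (\<phi> n) t"
        using F(2) M by (simp add: dense_along_def)
      then show ?thesis
        unfolding F'_def frequently_def eventually_inf_principal
        by (rule contrapos_nn) (use False in \<open>auto elim!: eventually_mono simp: agree_on_def\<close>)
    qed
    then have "F' = F"
      by (intro min) (auto simp: F'_def dense_along_def)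
    then have "forces \<phi> F N s P"
      unfolding forces_def F'_def by (metis (no_types, lifting) inf.cobounded2 le_principal mem_Collect_eq eventually_mono)
    then show False
      using und(1)[of N s] N by (simp add: agree_on_def)
  qed
  with F show ?thesis by blast
qed

section \<open>The generic filter at the origin\<close>

text \<open>The interior of \<open>P\<close> is dense in the basic neighbourhood of the origin given by \<open>N\<close>.\<close>

definition dense_near_zero :: "'i set \<Rightarrow> (('i \<Rightarrow> bool) \<Rightarrow> bool) \<Rightarrow> bool" where
  "dense_near_zero N P \<longleftrightarrow>
     (\<forall>M s. finite M \<longrightarrow> N \<subseteq> M \<longrightarrow> agree_on N s (\<lambda>_. False) \<longrightarrow>
       (\<exists>M' s'. finite M' \<and> M \<subseteq> M' \<and> agree_on M s s' \<and> (\<forall>y. agree_on M' y s' \<longrightarrow> P y)))"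

lemma dense_near_zeroD:
  assumes "dense_near_zero N P" "finite M" "N \<subseteq> M" "agree_on N s (\<lambda>_. False)"
  shows "\<exists>M' s'. finite M' \<and> M \<subseteq> M' \<and> agree_on M s s' \<and> (\<forall>y. agree_on M' y s' \<longrightarrow> P y)"
  using assms unfolding dense_near_zero_def by simp

text \<open>The filter generated by the neighbourhoods of the origin and the dense open sets: if the
  interior of \<open>P\<close> is dense in a clopen basic neighbourhood, then \<open>P\<close>
  contains the intersection of that neighbourhood with a dense open set.\<close>

definition cube_generic :: "('i \<Rightarrow> bool) filter" where
  "cube_generic = Abs_filter (\<lambda>P. \<exists>N. finite N \<and> dense_near_zero N P)"

lemma eventually_cube_generic:
  fixes P :: "('i \<Rightarrow> bool) \<Rightarrow> bool"
  shows "eventually P cube_generic \<longleftrightarrow> (\<exists>N. finite N \<and> dense_near_zero N P)"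
  unfolding cube_generic_def
proof (rule eventually_Abs_filter, rule is_filter.intro)
  have "dense_near_zero {} (\<lambda>_ :: 'i \<Rightarrow> bool. True)"
    unfolding dense_near_zero_def
  proof (intro allI impI)
    fix M :: "'i set" and s :: "'i \<Rightarrow> bool" assume "finite M"
    then show "\<exists>M' s'. finite M' \<and> M \<subseteq> M' \<and> agree_on M s s' \<and> (\<forall>y. agree_on M' y s' \<longrightarrow> True)"
      by (intro exI[of _ M] exI[of _ s]) (simp add: agree_on_def)
  qed
  then show "\<exists>N. finite N \<and> dense_near_zero N (\<lambda>_ :: 'i \<Rightarrow> bool. True)"
    by blast
next
  fix P Q :: "('i \<Rightarrow> bool) \<Rightarrow> bool"
  assume "\<exists>N. finite N \<and> dense_near_zero N P" "\<exists>N. finite N \<and> dense_near_zero N Q"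
  then obtain N K where N: "finite N" "dense_near_zero N P" and K: "finite K" "dense_near_zero K Q"
    by blast
  have "dense_near_zero (N \<union> K) (\<lambda>x. P x \<and> Q x)"
    unfolding dense_near_zero_def
  proof (intro allI impI)
    fix M s assume M: "finite M" "N \<union> K \<subseteq> M" "agree_on (N \<union> K) s (\<lambda>_. False)"
    then have "agree_on N s (\<lambda>_. False)" "N \<subseteq> M"
      by (auto simp: agree_on_def)
    then obtain M1 s1 where 1: "finite M1" "M \<subseteq> M1" "agree_on M s s1" "\<And>y. agree_on M1 y s1 \<Longrightarrow> P y"
      using dense_near_zeroD[OF N(2) M(1)] by meson
    \<comment> \<open>The extension found for \<open>P\<close> still agrees with the origin on
      \<open>K\<close>, so it can be refined once more, now into \<open>Q\<close>.\<close>
    have "agree_on K s1 (\<lambda>_. False)" "K \<subseteq> M1"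
      using M 1(2,3) by (auto simp: agree_on_def)
    then obtain M2 s2 where 2: "finite M2" "M1 \<subseteq> M2" "agree_on M1 s1 s2" "\<And>y. agree_on M2 y s2 \<Longrightarrow> Q y"
      using dense_near_zeroD[OF K(2) 1(1)] by meson
    have "agree_on M s s2"
      using 1(2,3) 2(3) by (auto simp: agree_on_def)
    moreover have "P y \<and> Q y" if "agree_on M2 y s2" for y
      using that 1(4)[of y] 2(2-4) by (auto simp: agree_on_def)
    ultimately show "\<exists>M' s'. finite M' \<and> M \<subseteq> M' \<and> agree_on M s s' \<and> (\<forall>y. agree_on M' y s' \<longrightarrow> P y \<and> Q y)"
      using 1(2) 2(1,2) by (intro exI[of _ M2] exI[of _ s2]) auto
  qed
  with N K show "\<exists>N. finite N \<and> dense_near_zero N (\<lambda>x. P x \<and> Q x)"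
    by (intro exI[of _ "N \<union> K"]) simp
next
  fix P Q :: "('i \<Rightarrow> bool) \<Rightarrow> bool"
  assume PQ: "\<forall>x. P x \<longrightarrow> Q x" and "\<exists>N. finite N \<and> dense_near_zero N P"
  moreover have "dense_near_zero N Q" if N: "dense_near_zero N P" for N
    unfolding dense_near_zero_def
  proof (intro allI impI)
    fix M s assume M: "finite M" "N \<subseteq> M" "agree_on N s (\<lambda>_. False)"
    show "\<exists>M' s'. finite M' \<and> M \<subseteq> M' \<and> agree_on M s s' \<and> (\<forall>y. agree_on M' y s' \<longrightarrow> Q y)"
    proof -
      obtain M' s' where "finite M'" "M \<subseteq> M'" "agree_on M s s'" "\<forall>y. agree_on M' y s' \<longrightarrow> P y"
        using dense_near_zeroD[OF N M] by blast
      then show ?thesis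
        using PQ by (intro exI[of _ M'] exI[of _ s']) simp
    qed
  qed
  ultimately show "\<exists>N. finite N \<and> dense_near_zero N Q"
    by blast
qed

lemma cube_generic_neq_bot: "(cube_generic :: ('i \<Rightarrow> bool) filter) \<noteq> bot"
proof
  assume "(cube_generic :: ('i \<Rightarrow> bool) filter) = bot"
  then have "eventually (\<lambda>_. False) (cube_generic :: ('i \<Rightarrow> bool) filter)"
    by simp
  then obtain N :: "'i set" where "finite N" "dense_near_zero N (\<lambda>_. False)"
    unfolding eventually_cube_generic by blast
  moreover have "agree_on N (\<lambda>_. False) (\<lambda>_. False)"
    by (simp add: agree_on_def)
  ultimately obtain M' :: "'i set" and s' :: "'i \<Rightarrow> bool" where "\<forall>y. agree_on M' y s' \<longrightarrow> False"
    using dense_near_zeroD[of N "\<lambda>_. False" N "\<lambda>_. False"] by auto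
  then show False
    using agree_onI[of M' s' s'] by blast
qed

section \<open>Countable supports\<close>

text \<open>Close off under a choice of deciding extensions in \<open>\<omega>\<close> steps. A
  countable set of coordinates carries only countably many finite conditions, so each stage stays
  countable, and a finite \<open>N\<close> inside the union lies inside one stage.\<close>

lemma countable_deciding_support:
  assumes "\<And>N s. finite N \<Longrightarrow>
     \<exists>M t. finite M \<and> N \<subseteq> M \<and> agree_on N s t \<and> (D :: 'i set \<Rightarrow> ('i \<Rightarrow> bool) \<Rightarrow> bool) M t"
  shows "\<exists>J. countable J \<and> (\<forall>N s. finite N \<longrightarrow> N \<subseteq> J \<longrightarrow>
     (\<exists>M t. finite M \<and> N \<subseteq> M \<and> M \<subseteq> J \<and> agree_on N s t \<and> D M t))"
proof -
  \<comment> \<open>The pattern of \<open>s\<close> on \<open>N\<close> is coded by the set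
    \<open>R\<close> of places where it is true. So it suffices to let \<open>R\<close> range over
    the finite set \<open>Pow N\<close>.\<close>
  have "\<forall>N R. \<exists>M. finite N \<longrightarrow> finite M \<and> N \<subseteq> M \<and> (\<exists>t. agree_on N (\<lambda>i. i \<in> R) t \<and> D M t)"
    using assms by metis
  then obtain m where m: "\<And>N R. finite N \<Longrightarrow>
      finite (m N R) \<and> N \<subseteq> m N R \<and> (\<exists>t. agree_on N (\<lambda>i. i \<in> R) t \<and> D (m N R) t)"
    by metis
  define step where "step J = J \<union> (\<Union>N\<in>{N. finite N \<and> N \<subseteq> J}. \<Union>R\<in>Pow N. m N R)" for J
  define J where "J n = (step ^^ n) {}" for n
  have JSuc: "J (Suc n) = step (J n)" for n
    by (simp add: J_def)
  have cnt: "countable (J n)" for n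
  proof (induction n)
    case 0
    then show ?case by (simp add: J_def)
  next
    case (Suc n)
    have "countable {N. finite N \<and> N \<subseteq> J n}"
      using countable_Collect_finite_subset[OF Suc] by (simp add: conj_commute)
    then show ?case
      unfolding JSuc step_def using Suc m
      by (auto intro!: countable_Un countable_UN intro: countable_finite)
  qed
  have mono: "J n \<subseteq> J k" if "n \<le> k" for n k
    using that by (rule lift_Suc_mono_le[rotated]) (auto simp: JSuc step_def)
  show ?thesis
  proof (rule exI[of _ "\<Union>n. J n"], intro conjI allI impI)
    show "countable (\<Union>n. J n)"
      using cnt by auto
    fix N :: "'i set" and s :: "'i \<Rightarrow> bool"
    assume N: "finite N" "N \<subseteq> (\<Union>n. J n)"
    have "\<exists>n. N \<subseteq> J n"
      using N
    proof (induction N)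
      case empty
      then show ?case by simp
    next
      case (insert x N)
      then obtain n k where "N \<subseteq> J n" "x \<in> J k"
        by auto
      then have "insert x N \<subseteq> J (max n k)"
        using mono[of n "max n k"] mono[of k "max n k"] by auto
      then show ?case ..
    qed
    then obtain n where n: "N \<subseteq> J n" ..
    let ?R = "{i\<in>N. s i}"
    obtain t where t: "agree_on N (\<lambda>i. i \<in> ?R) t" "D (m N ?R) t"
      using m[OF N(1)] by blast
    have "m N ?R \<subseteq> J (Suc n)"
      unfolding JSuc step_def using N(1) n by auto
    moreover have "agree_on N s t"
      using t(1) by (auto simp: agree_on_def)
    ultimately show "\<exists>M t. finite M \<and> N \<subseteq> M \<and> M \<subseteq> (\<Union>n. J n) \<and> agree_on N s t \<and> D M t"
      using t(2) m[OF N(1)] by blast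
  qed
qed

section \<open>The ultrafilters over the points of the cube\<close>

text \<open>A set belongs to \<open>u z\<close> if, for \<open>\<U>\<close>-most \<open>y\<close>,
  it is forced by a finite part of \<open>y\<close> translated by \<open>z\<close>. Since
  \<open>\<U>\<close> contains all dense open sets, \<open>u z\<close> decides every
  \<open>P\<close>; since it contains the neighbourhoods of the origin, \<open>u z\<close> lies over
  \<open>z\<close>.\<close>

theorem exists_continuous_ultrafilters:
  fixes \<phi> :: "'a \<Rightarrow> 'i \<Rightarrow> bool"
  assumes "dense_along \<phi> F0"
  shows "\<exists>u. (\<forall>z. ultra (u z) \<and> u z \<le> F0 \<and> (\<forall>i. \<forall>\<^sub>F n in u z. \<phi> n i = z i)) \<and>
    (\<forall>P. \<exists>J. countable J \<and> (\<forall>z z'. agree_on J z z' \<longrightarrow> eventually P (u z) \<longrightarrow> eventually P (u z')))"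
proof -
  obtain F where F: "F \<le> F0" "dense_along \<phi> F" and decide: "\<And>P N s. finite N \<Longrightarrow>
      \<exists>M t. finite M \<and> N \<subseteq> M \<and> agree_on N s t \<and>
        (forces \<phi> F M t P \<or> forces \<phi> F M t (\<lambda>n. \<not> P n))"
    using exists_deciding_filter[OF assms] by blast
  obtain \<U> :: "('i \<Rightarrow> bool) filter" where \<U>: "\<U> \<le> cube_generic" "ultra \<U>"
    using exists_ultra_le[OF cube_generic_neq_bot] by blast
  have \<U>_bot: "\<U> \<noteq> bot"
    using \<U>(2) by (simp add: ultra_def)
  \<comment> \<open>Coordinatewise sum modulo 2: translation by \<open>z\<close>, an involution that
    moves the origin to \<open>z\<close>.\<close>
  define x where "x y z = (\<lambda>i. y i \<noteq> z i)" for y z :: "'i \<Rightarrow> bool"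
  define germ where "germ P y \<longleftrightarrow> (\<exists>N. finite N \<and> forces \<phi> F N y P)" for P y
  define u where "u z = Abs_filter (\<lambda>P. \<forall>\<^sub>F y in \<U>. germ P (x y z))" for z
  have germ_True: "germ P y" if "eventually P F" for P y
    unfolding germ_def forces_def by (intro exI[of _ "{}"]) (use that in \<open>auto elim: eventually_mono\<close>)
  have germ_mono: "germ Q y" if P: "germ P y" and PQ: "\<And>n. P n \<Longrightarrow> Q n" for P Q y
  proof -
    obtain N where "finite N" "forces \<phi> F N y P"
      using P unfolding germ_def by blast
    then have "finite N \<and> forces \<phi> F N y Q"
      unfolding forces_def using PQ by (auto elim: eventually_mono)
    then show ?thesis
      unfolding germ_def ..
  qed
  have germ_conj: "germ (\<lambda>n. P n \<and> Q n) y" if P: "germ P y" and Q: "germ Q y" for P Q y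
  proof -
    obtain N M where "finite N" "forces \<phi> F N y P" "finite M" "forces \<phi> F M y Q"
      using P Q unfolding germ_def by blast
    then show ?thesis
      unfolding germ_def by (intro exI[of _ "N \<union> M"]) (simp add: forces_conj)
  qed
  have germ_contra: False if "germ P y" "germ (\<lambda>n. \<not> P n) y" for P y
    using that forces_contradiction[OF F(2)] unfolding germ_def by blast
  have ev: "eventually P (u z) \<longleftrightarrow> (\<forall>\<^sub>F y in \<U>. germ P (x y z))" for P z
    unfolding u_def
  proof (rule eventually_Abs_filter, rule is_filter.intro)
    show "\<forall>\<^sub>F y in \<U>. germ (\<lambda>_. True) (x y z)"
      by (simp add: germ_True)
  next
    fix P Q assume "\<forall>\<^sub>F y in \<U>. germ P (x y z)" "\<forall>\<^sub>F y in \<U>. germ Q (x y z)"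
    then show "\<forall>\<^sub>F y in \<U>. germ (\<lambda>n. P n \<and> Q n) (x y z)"
      by eventually_elim (rule germ_conj)
  next
    fix P Q assume "\<forall>n. P n \<longrightarrow> Q n" "\<forall>\<^sub>F y in \<U>. germ P (x y z)"
    then show "\<forall>\<^sub>F y in \<U>. germ Q (x y z)"
      by (auto elim!: eventually_mono germ_mono)
  qed
  \<comment> \<open>One \<open>J\<close> serves all \<open>z\<close>: the conditions supported in
    \<open>J\<close> that decide \<open>P\<close> give a dense open set, and each of its translates
    is dense open as well, hence in \<open>\<U>\<close>.\<close>
  have supp: "\<exists>J. countable J \<and> (\<forall>z. \<forall>\<^sub>F y in \<U>. \<exists>M. finite M \<and> M \<subseteq> J \<and>
        (forces \<phi> F M (x y z) P \<or> forces \<phi> F M (x y z) (\<lambda>n. \<not> P n)))" for P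
  proof -
    obtain J where J: "countable J" "\<And>N s. finite N \<Longrightarrow> N \<subseteq> J \<Longrightarrow>
      \<exists>M t. finite M \<and> N \<subseteq> M \<and> M \<subseteq> J \<and> agree_on N s t \<and>
        (forces \<phi> F M t P \<or> forces \<phi> F M t (\<lambda>n. \<not> P n))"
      using countable_deciding_support[OF decide[of _ _ P]] by blast
    have "\<forall>\<^sub>F y in cube_generic. \<exists>M. finite M \<and> M \<subseteq> J \<and>
        (forces \<phi> F M (x y z) P \<or> forces \<phi> F M (x y z) (\<lambda>n. \<not> P n))" for z
      unfolding eventually_cube_generic dense_near_zero_def
    proof (rule exI[of _ "{}"], intro conjI allI impI)
      fix M0 s assume M0: "finite (M0 :: 'i set)"
      obtain M t where M: "finite M" "M0 \<inter> J \<subseteq> M" "M \<subseteq> J" "agree_on (M0 \<inter> J) (x s z) t"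
        and dec: "forces \<phi> F M t P \<or> forces \<phi> F M t (\<lambda>n. \<not> P n)"
        using J(2)[of "M0 \<inter> J" "x s z"] M0 by auto
      \<comment> \<open>On \<open>M\<close> this makes the translate of \<open>s'\<close> equal to
        \<open>t\<close>. It still extends \<open>s\<close> on \<open>M0\<close>, because
        \<open>M\<close> lies in \<open>J\<close> and \<open>t\<close> agrees with the translate of
        \<open>s\<close> on \<open>M0 \<inter> J\<close>.\<close>
      define s' where "s' = (\<lambda>i. if i \<in> M then x t z i else s i)"
      have "agree_on M0 s s'"
        using M(3,4) by (auto simp: s'_def agree_on_def x_def)
      moreover have "forces \<phi> F M (x y z) P \<or> forces \<phi> F M (x y z) (\<lambda>n. \<not> P n)"
        if "agree_on (M0 \<union> M) y s'" for y
      proof -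
        have "agree_on M (x y z) t"
          using that by (auto simp: s'_def agree_on_def x_def)
        then show ?thesis
          using dec by (simp add: forces_cong)
      qed
      ultimately show "\<exists>M' s'. finite M' \<and> M0 \<subseteq> M' \<and> agree_on M0 s s' \<and>
          (\<forall>y. agree_on M' y s' \<longrightarrow> (\<exists>M. finite M \<and> M \<subseteq> J \<and>
            (forces \<phi> F M (x y z) P \<or> forces \<phi> F M (x y z) (\<lambda>n. \<not> P n))))"
        using M0 M(1,3) by (intro exI[of _ "M0 \<union> M"] exI[of _ s']) blast
    qed simp
    then have "\<forall>\<^sub>F y in \<U>. \<exists>M. finite M \<and> M \<subseteq> J \<and>
        (forces \<phi> F M (x y z) P \<or> forces \<phi> F M (x y z) (\<lambda>n. \<not> P n))" for z
      by (rule filter_leD[OF \<U>(1)])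
    with J(1) show ?thesis
      by blast
  qed
  have "ultra (u z)" for z
    unfolding ultra_def
  proof (intro conjI allI)
    show "u z \<noteq> bot"
    proof
      assume "u z = bot"
      then have "\<forall>\<^sub>F y in \<U>. germ (\<lambda>_. False) (x y z)"
        by (simp flip: ev)
      then obtain y where "germ (\<lambda>_. False) (x y z)"
        using \<U>_bot eventually_happens' by blast
      then show False
        using germ_contra[of "\<lambda>_. False"] germ_True[of "\<lambda>_. True"] by simp
    qed
    fix P
    obtain J where "\<forall>\<^sub>F y in \<U>. \<exists>M. finite M \<and> M \<subseteq> J \<and>
        (forces \<phi> F M (x y z) P \<or> forces \<phi> F M (x y z) (\<lambda>n. \<not> P n))"
      using supp by blast
    then have *: "\<forall>\<^sub>F y in \<U>. germ P (x y z) \<or> germ (\<lambda>n. \<not> P n) (x y z)"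
      by (rule eventually_mono) (auto simp: germ_def)
    show "eventually P (u z) \<or> eventually (\<lambda>n. \<not> P n) (u z)"
    proof (cases "\<forall>\<^sub>F y in \<U>. germ P (x y z)")
      case False
      then have "\<forall>\<^sub>F y in \<U>. \<not> germ P (x y z)"
        using \<U>(2) by (simp add: ultra_not_eventually)
      with * have "\<forall>\<^sub>F y in \<U>. germ (\<lambda>n. \<not> P n) (x y z)"
        by eventually_elim blast
      then show ?thesis
        by (simp add: ev)
    qed (simp add: ev)
  qed
  moreover have "u z \<le> F0" for z
  proof (rule filter_leI)
    fix P assume "eventually P F0"
    then have "germ P y" for y
      using F(1) filter_leD germ_True by blast
    then show "eventually P (u z)"
      by (simp add: ev)
  qed
  moreover have "\<forall>\<^sub>F n in u z. \<phi> n i = z i" for z i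
  proof -
    \<comment> \<open>Here the neighbourhoods of the origin enter: where \<open>y i\<close> is
      false, \<open>x y z\<close> has the value \<open>z i\<close> at \<open>i\<close>.\<close>
    have "\<forall>\<^sub>F y in cube_generic. \<not> y i"
      unfolding eventually_cube_generic dense_near_zero_def
    proof (rule exI[of _ "{i}"], intro conjI allI impI)
      fix M s assume "finite M" "{i} \<subseteq> M" "agree_on {i} s (\<lambda>_. False)"
      then show "\<exists>M' s'. finite M' \<and> M \<subseteq> M' \<and> agree_on M s s' \<and> (\<forall>y. agree_on M' y s' \<longrightarrow> \<not> y i)"
        by (intro exI[of _ M] exI[of _ s]) (auto simp: agree_on_def)
    qed simp
    then have "\<forall>\<^sub>F y in \<U>. \<not> y i"
      by (rule filter_leD[OF \<U>(1)])
    then show ?thesis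
      unfolding ev
      by (rule eventually_mono)
        (auto simp: germ_def forces_def x_def agree_on_def intro!: exI[of _ "{i}"])
  qed
  moreover have "\<exists>J. countable J \<and> (\<forall>z z'. agree_on J z z' \<longrightarrow> eventually P (u z) \<longrightarrow> eventually P (u z'))" for P
  proof -
    obtain J where J: "countable J" "\<And>z. \<forall>\<^sub>F y in \<U>. \<exists>M. finite M \<and> M \<subseteq> J \<and>
        (forces \<phi> F M (x y z) P \<or> forces \<phi> F M (x y z) (\<lambda>n. \<not> P n))"
      using supp by blast
    have "eventually P (u z')" if zz': "agree_on J z z'" and "eventually P (u z)" for z z'
    proof -
      have "\<forall>\<^sub>F y in \<U>. germ P (x y z)"
        using that by (simp add: ev)
      then have "\<forall>\<^sub>F y in \<U>. germ P (x y z')"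
        using J(2)[of z]
      proof eventually_elim
        \<comment> \<open>\<open>P\<close> and its negation cannot both be forced, so the decision
          supported in \<open>J\<close> must be for \<open>P\<close>; having its support in
          \<open>J\<close>, it transfers to \<open>z'\<close>.\<close>
        case (elim y)
        then obtain M where M: "finite M" "M \<subseteq> J"
          "forces \<phi> F M (x y z) P \<or> forces \<phi> F M (x y z) (\<lambda>n. \<not> P n)"
          by blast
        then have "forces \<phi> F M (x y z) P"
          using germ_contra[OF elim(1)] unfolding germ_def by blast
        moreover have "agree_on M (x y z) (x y z')"
          using zz' M(2) by (auto simp: agree_on_def x_def)
        ultimately show ?case
          using M(1) forces_cong[of M "x y z" "x y z'"] unfolding germ_def by blast
      qed
      then show ?thesis
        by (simp add: ev)
    qed
    with J(1) show ?thesis by blast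
  qed
  ultimately show ?thesis
    by (intro exI[of _ u]) blast
qed

section \<open>An independent family of size continuum\<close>

text \<open>The classical construction of Fichtenholz, Kantorovich and Hausdorff: \<open>n\<close>
  codes a length \<open>k\<close> and a finite list \<open>L\<close> of binary words, and
  \<open>f\<close> is tested by whether its prefix of length \<open>k\<close> occurs in
  \<open>L\<close>.\<close>

lemma exists_independent_family:
  "\<exists>\<phi> :: nat \<Rightarrow> (nat \<Rightarrow> bool) \<Rightarrow> bool. dense_along \<phi> sequentially"
proof -
  define \<phi> :: "nat \<Rightarrow> (nat \<Rightarrow> bool) \<Rightarrow> bool" where
    "\<phi> n f = (let (k, L) = (from_nat n :: nat \<times> bool list list) in map f [0..<k] \<in> set L)" for n f
  have "\<exists>\<^sub>F n in sequentially. agree_on N (\<phi> n) s" if N: "finite N" for N s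
  proof -
    \<comment> \<open>Finitely many sequences are told apart by all sufficiently long prefixes.
      Having every large \<open>k\<close> available yields infinitely many \<open>n\<close>, as
      \<open>frequently\<close> along \<open>sequentially\<close> requires.\<close>
    have "\<exists>k0. \<forall>k\<ge>k0. inj_on (\<lambda>f. map f [0..<k]) N"
      using N
    proof (induction N)
      case empty
      then show ?case by simp
    next
      case (insert g N)
      then obtain k0 where k0: "\<And>k. k \<ge> k0 \<Longrightarrow> inj_on (\<lambda>f. map f [0..<k]) N"
        by blast
      have "\<exists>m. \<forall>f\<in>N. \<exists>i<m. f i \<noteq> g i"
      proof -
        have "\<exists>i. f i \<noteq> g i" if "f \<in> N" for f
        proof -
          have "f \<noteq> g"
            using that insert.hyps(2) by blast
          then show ?thesis
            by (simp add: fun_eq_iff)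
        qed
        then obtain d where "\<And>f. f \<in> N \<Longrightarrow> f (d f) \<noteq> g (d f)"
          by metis
        moreover have "d f < Suc (Max (d ` N))" if "f \<in> N" for f
          using that insert.hyps(1) by (simp add: le_imp_less_Suc)
        ultimately show ?thesis by blast
      qed
      then obtain m where m: "\<And>f. f \<in> N \<Longrightarrow> \<exists>i<m. f i \<noteq> g i"
        by blast
      have "inj_on (\<lambda>f. map f [0..<k]) (insert g N)" if "k \<ge> max k0 m" for k
      proof -
        have "map f [0..<k] \<noteq> map g [0..<k]" if "f \<in> N" for f
        proof -
          obtain i where "i < m" "f i \<noteq> g i"
            using m[OF \<open>f \<in> N\<close>] by blast
          then have "i \<in> set [0..<k]"
            using \<open>k \<ge> max k0 m\<close> by auto
          with \<open>f i \<noteq> g i\<close> show ?thesis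
            unfolding map_eq_conv by blast
        qed
        then have "map g [0..<k] \<notin> (\<lambda>f. map f [0..<k]) ` (N - {g})"
          by (metis (no_types, lifting) DiffD1 imageE)
        then show ?thesis
          using k0[of k] \<open>k \<ge> max k0 m\<close> by (simp add: inj_on_insert)
      qed
      then show ?case by blast
    qed
    then obtain k0 where k0: "\<And>k. k \<ge> k0 \<Longrightarrow> inj_on (\<lambda>f. map f [0..<k]) N"
      by blast
    \<comment> \<open>The list holds the prefixes of exactly those \<open>f\<close> in
      \<open>N\<close> at which \<open>s\<close> is true; the component \<open>k\<close> makes
      \<open>code\<close> injective.\<close>
    define code where "code k = to_nat (k :: nat, SOME L. set L = (\<lambda>f. map f [0..<k]) ` {f\<in>N. s f})" for k
    have "agree_on N (\<phi> (code k)) s" if "k \<ge> k0" for k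
    proof -
      have "\<exists>L. set L = (\<lambda>f. map f [0..<k]) ` {f\<in>N. s f}"
        using N by (intro finite_list) simp
      then have L: "set (SOME L. set L = (\<lambda>f. map f [0..<k]) ` {f\<in>N. s f}) = (\<lambda>f. map f [0..<k]) ` {f\<in>N. s f}"
        by (rule someI_ex)
      have "\<phi> (code k) f \<longleftrightarrow> map f [0..<k] \<in> (\<lambda>f. map f [0..<k]) ` {f\<in>N. s f}" for f
        unfolding \<phi>_def code_def by (simp only: from_nat_to_nat Let_def prod.case L)
      then show ?thesis
        using k0[OF that] by (auto simp: agree_on_def inj_on_def simp del: map_eq_conv)
    qed
    then have "code ` {k0..} \<subseteq> {n. agree_on N (\<phi> n) s}"
      by auto
    moreover have "inj code"
      by (auto simp: inj_on_def code_def)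
    then have "infinite (code ` {k0..})"
      by (meson finite_imageD infinite_Ici inj_on_subset subset_UNIV)
    ultimately have "infinite {n. agree_on N (\<phi> n) s}"
      using infinite_super by blast
    then show ?thesis
      by (simp add: frequently_cofinite flip: cofinite_eq_sequentially)
  qed
  then show ?thesis
    unfolding dense_along_def by blast
qed

lemma dense_along_reindex:
  assumes "dense_along \<phi> F" "inj h"
  shows "dense_along (\<lambda>n i. \<phi> n (h i)) F"
  unfolding dense_along_def
proof (intro allI impI)
  fix N s assume "finite (N :: 'c set)"
  then have "\<exists>\<^sub>F n in F. agree_on (h ` N) (\<phi> n) (s \<circ> inv h)"
    using assms(1) by (simp add: dense_along_def)
  then show "\<exists>\<^sub>F n in F. agree_on N (\<lambda>i. \<phi> n (h i)) s"
    by (rule frequently_elim1) (use assms(2) in \<open>simp add: agree_on_def\<close>)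
qed

section \<open>Ultrafilters as points of the remainder\<close>

abbreviation (input) omega :: "nat topology" where
  "omega \<equiv> discrete_topology UNIV"

text \<open>The limit along \<open>u\<close> of the embedded integers; the coordinate at
  \<open>f\<close> is the value at \<open>u\<close> of the continuous extension of
  \<open>f\<close>.\<close>

definition ultra_point :: "nat filter \<Rightarrow> (nat \<Rightarrow> real) \<Rightarrow> real" where
  "ultra_point u = (\<lambda>f\<in>unit_maps omega. Lim u f)"

lemma unit_maps_omega: "f \<in> unit_maps omega \<longleftrightarrow> (\<forall>n. f n \<in> {0..1})"
  by (auto simp: unit_maps_def continuous_map_in_subtopology)

lemma tendsto_ultra_point:
  assumes "ultra u" "f \<in> unit_maps omega"
  shows "(f \<longlongrightarrow> ultra_point u f) u" "ultra_point u f \<in> {0..1}"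
proof -
  obtain l where l: "l \<in> {0..1}" "(f \<longlongrightarrow> l) u"
    using ultra_tendsto_in_compact[OF assms(1) compact_Icc, of f 0 1] assms(2) unit_maps_omega by blast
  moreover have "ultra_point u f = l"
    using l(2) assms by (simp add: ultra_point_def tendsto_Lim ultra_def)
  ultimately show "(f \<longlongrightarrow> ultra_point u f) u" "ultra_point u f \<in> {0..1}"
    by simp_all
qed

definition char_fun :: "(nat \<Rightarrow> bool) \<Rightarrow> nat \<Rightarrow> real" where
  "char_fun P n = (if P n then 1 else 0)"

lemma char_fun_unit_map: "char_fun P \<in> unit_maps omega"
  by (simp add: unit_maps_omega char_fun_def)

lemma ultra_point_char_fun:
  assumes "ultra u"
  shows "ultra_point u (char_fun P) = (if eventually P u then 1 else 0)"
proof -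
  have "(char_fun P \<longlongrightarrow> (if eventually P u then 1 else 0)) u"
  proof (cases "eventually P u")
    case True
    then show ?thesis
      by (auto intro!: tendsto_eventually elim!: eventually_mono simp: char_fun_def)
  next
    case False
    then have "eventually (\<lambda>n. \<not> P n) u"
      using assms by (simp add: ultra_not_eventually)
    with False show ?thesis
      by (auto intro!: tendsto_eventually elim!: eventually_mono simp: char_fun_def)
  qed
  then show ?thesis
    using assms char_fun_unit_map by (simp add: ultra_point_def tendsto_Lim ultra_def)
qed

lemma topspace_omega_star:
  "topspace omega_star = tychonoff_cube omega closure_of (range (stone_cech_map omega)) - range (stone_cech_map omega)"
  by (auto simp: stone_cech_remainder_def stone_cech_def dest: in_closure_of[THEN iffD1])

text \<open>Collapses the nested subspaces to one, so that limits and continuity can be checked in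
  the cube.\<close>

lemma omega_star_subtopology: "omega_star = subtopology (tychonoff_cube omega) (topspace omega_star)"
proof -
  have "omega_star = subtopology (tychonoff_cube omega)
      (tychonoff_cube omega closure_of range (stone_cech_map omega) \<inter>
       (topspace (stone_cech omega) - range (stone_cech_map omega)))"
    by (simp add: stone_cech_remainder_def stone_cech_def subtopology_subtopology)
  also have "\<dots> = subtopology (tychonoff_cube omega) (topspace omega_star)"
    by (rule arg_cong[where f = "subtopology _"])
       (auto simp: stone_cech_remainder_def stone_cech_def dest: in_closure_of[THEN iffD1])
  finally show ?thesis .
qed

lemma limitin_tychonoff_cube:
  assumes "l \<in> extensional (unit_maps omega)" "\<And>a. x a \<in> extensional (unit_maps omega)"
    and "\<And>f. f \<in> unit_maps omega \<Longrightarrow> l f \<in> {0..1}" "\<And>f a. f \<in> unit_maps omega \<Longrightarrow> x a f \<in> {0..1}"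
    and "\<And>f. f \<in> unit_maps omega \<Longrightarrow> ((\<lambda>a. x a f) \<longlongrightarrow> l f) F"
  shows "limitin (tychonoff_cube omega) x l F"
  unfolding tychonoff_cube_def limitin_componentwise
  using assms by (auto simp: PiE_iff limitin_subtopology)

text \<open>The embedded integers converge to the point along \<open>u\<close>, which puts it in
  their closure. It is not the image of any \<open>n\<close>: as \<open>u\<close> is free, the
  indicator of \<open>k \<noteq> n\<close> has limit 1 along \<open>u\<close>, but it vanishes at
  \<open>n\<close>.\<close>

lemma ultra_point_in_omega_star:
  assumes "ultra u" "u \<le> sequentially"
  shows "ultra_point u \<in> topspace omega_star"
proof -
  have "limitin (tychonoff_cube omega) (stone_cech_map omega) (ultra_point u) u"
  proof (rule limitin_tychonoff_cube)
    fix f assume f: "f \<in> unit_maps omega"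
    then show "ultra_point u f \<in> {0..1}" "stone_cech_map omega n f \<in> {0..1}" for n
      using tendsto_ultra_point(2)[OF assms(1) f] unit_maps_omega by (auto simp: stone_cech_map_def)
    show "((\<lambda>n. stone_cech_map omega n f) \<longlongrightarrow> ultra_point u f) u"
      using tendsto_ultra_point(1)[OF assms(1) f] f by (simp add: stone_cech_map_def)
  qed (simp_all add: ultra_point_def stone_cech_map_def)
  then have "ultra_point u \<in> tychonoff_cube omega closure_of range (stone_cech_map omega)"
    unfolding limitin_def in_closure_of
    using assms(1) eventually_happens'[of u] by (fastforce simp: ultra_def)
  moreover have "ultra_point u \<noteq> stone_cech_map omega n" for n
  proof
    assume eq: "ultra_point u = stone_cech_map omega n"
    have "eventually (\<lambda>k. k \<noteq> n) u"
      using filter_leD[OF assms(2) eventually_gt_at_top[of n]] by (rule eventually_mono) simp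
    then have "ultra_point u (char_fun (\<lambda>k. k \<noteq> n)) = 1"
      by (simp add: ultra_point_char_fun assms(1))
    then show False
      unfolding eq by (simp add: stone_cech_map_def char_fun_unit_map, simp add: char_fun_def)
  qed
  ultimately show ?thesis
    unfolding topspace_omega_star by blast
qed

text \<open>At \<open>ultra_point u\<close> this coordinate is 1 or 0 according to whether
  \<open>P\<close> belongs to \<open>u\<close>, so the threshold 1/2 turns membership in
  \<open>u\<close> into an open condition.\<close>

lemma openin_omega_star_char_fun: "openin omega_star {x \<in> topspace omega_star. x (char_fun P) > 1/2}"
proof -
  have "continuous_map (tychonoff_cube omega) euclideanreal (\<lambda>x. x (char_fun P))"
    unfolding tychonoff_cube_def
    using continuous_map_product_projection[OF char_fun_unit_map]
    by (metis continuous_map_in_subtopology)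
  then have "continuous_map omega_star euclideanreal (\<lambda>x. x (char_fun P))"
    by (metis omega_star_subtopology continuous_map_from_subtopology)
  then have "openin omega_star {x \<in> topspace omega_star. x (char_fun P) \<in> {1/2<..}}"
    by (rule openin_continuous_map_preimage) simp
  then show ?thesis by simp
qed

text \<open>Continuity at \<open>z\<close> when the cube carries the topology of countably supported
  boxes. In each coordinate, closeness to the limit is witnessed by a set in \<open>u z\<close>,
  whose membership depends on countably many coordinates of \<open>z\<close>.\<close>

lemma ultra_point_neighbourhood:
  fixes u :: "('i \<Rightarrow> 'b) \<Rightarrow> nat filter"
  assumes u: "\<And>z. ultra (u z)" "\<And>z. u z \<le> sequentially"
    and supp: "\<And>P. \<exists>J. countable J \<and> (\<forall>z z'. agree_on J z z' \<longrightarrow> eventually P (u z) \<longrightarrow> eventually P (u z'))"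
    and U: "openin omega_star U" "ultra_point (u z) \<in> U"
  shows "\<exists>J. countable J \<and> (\<forall>z'. agree_on J z z' \<longrightarrow> ultra_point (u z') \<in> U)"
proof -
  \<comment> \<open>The neighbourhood filter of \<open>z\<close> in that topology; it turns the
    claim into a limit that is checked coordinatewise.\<close>
  define \<N> where "\<N> = (INF J\<in>Collect countable. principal {z'. agree_on J z z'})"
  have ev: "eventually P \<N> \<longleftrightarrow> (\<exists>J. countable J \<and> (\<forall>z'. agree_on J z z' \<longrightarrow> P z'))" for P
  proof -
    have "eventually P \<N> \<longleftrightarrow> (\<exists>J\<in>Collect countable. eventually P (principal {z'. agree_on J z z'}))"
      unfolding \<N>_def
    proof (rule eventually_INF_base)
      fix J K :: "'i set" assume "J \<in> Collect countable" "K \<in> Collect countable"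
      then show "\<exists>L\<in>Collect countable. principal {z'. agree_on L z z'}
          \<le> inf (principal {z'. agree_on J z z'}) (principal {z'. agree_on K z z'})"
        by (intro bexI[of _ "J \<union> K"]) (auto simp: agree_on_def)
    qed auto
    then show ?thesis
      by (auto simp: eventually_principal)
  qed
  have "limitin (tychonoff_cube omega) (\<lambda>z'. ultra_point (u z')) (ultra_point (u z)) \<N>"
  proof (rule limitin_tychonoff_cube)
    fix f assume f: "f \<in> unit_maps omega"
    show "ultra_point (u z) f \<in> {0..1}"
      by (rule tendsto_ultra_point(2)[OF u(1) f])
    show "((\<lambda>z'. ultra_point (u z') f) \<longlongrightarrow> ultra_point (u z) f) \<N>"
    proof (rule tendstoI)
      fix e :: real assume e: "e > 0"
      \<comment> \<open>A weak inequality passes to the limit along \<open>u z'\<close>; the factor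
        1/2 leaves room for the strict bound.\<close>
      let ?P = "\<lambda>n. dist (f n) (ultra_point (u z) f) \<le> e / 2"
      have "eventually (\<lambda>n. dist (f n) (ultra_point (u z) f) < e / 2) (u z)"
        using tendsto_ultra_point(1)[OF u(1) f] e by (intro tendstoD) auto
      then have P: "eventually ?P (u z)"
        by (rule eventually_mono) simp
      obtain J where J: "countable J" "\<And>z z'. agree_on J z z' \<Longrightarrow> eventually ?P (u z) \<Longrightarrow> eventually ?P (u z')"
        using supp[of ?P] by blast
      have "dist (ultra_point (u z') f) (ultra_point (u z) f) < e" if "agree_on J z z'" for z'
      proof -
        have "((\<lambda>n. dist (f n) (ultra_point (u z) f)) \<longlongrightarrow> dist (ultra_point (u z') f) (ultra_point (u z) f)) (u z')"
          by (intro tendsto_intros tendsto_ultra_point(1) u(1) f)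
        then have "dist (ultra_point (u z') f) (ultra_point (u z) f) \<le> e / 2"
          using J(2)[OF that P] u(1)[of z'] by (intro tendsto_upperbound) (auto simp: ultra_def)
        then show ?thesis using e by simp
      qed
      with J(1) show "\<forall>\<^sub>F z' in \<N>. dist (ultra_point (u z') f) (ultra_point (u z) f) < e"
        unfolding ev by blast
    qed
  next
    fix f z' assume f: "f \<in> unit_maps omega"
    show "ultra_point (u z') f \<in> {0..1}"
      by (rule tendsto_ultra_point(2)[OF u(1) f])
  qed (simp_all add: ultra_point_def)
  then have "limitin omega_star (\<lambda>z'. ultra_point (u z')) (ultra_point (u z)) \<N>"
    by (subst omega_star_subtopology) (simp add: limitin_subtopology ultra_point_in_omega_star u)
  then show ?thesis
    using U unfolding limitin_def ev by blast
qed

section \<open>Copies of the space of a cardinal\<close>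

lemma Card_order_linear:
  assumes "Card_order \<kappa>"
  shows Card_order_total: "\<And>\<xi> \<eta>. \<xi> \<in> Field \<kappa> \<Longrightarrow> \<eta> \<in> Field \<kappa> \<Longrightarrow> (\<xi>, \<eta>) \<in> \<kappa> \<or> (\<eta>, \<xi>) \<in> \<kappa>"
    and Card_order_trans: "\<And>\<xi> \<eta> \<zeta>. (\<xi>, \<eta>) \<in> \<kappa> \<Longrightarrow> (\<eta>, \<zeta>) \<in> \<kappa> \<Longrightarrow> (\<xi>, \<zeta>) \<in> \<kappa>"
    and Card_order_antisym: "\<And>\<xi> \<eta>. (\<xi>, \<eta>) \<in> \<kappa> \<Longrightarrow> (\<eta>, \<xi>) \<in> \<kappa> \<Longrightarrow> \<xi> = \<eta>"
    and Card_order_wf: "wf (\<kappa> - Id)"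
proof -
  have wo: "Well_order \<kappa>"
    using assms by (simp add: card_order_on_def)
  then have lin: "Linear_order \<kappa>" and "wf (\<kappa> - Id)"
    by (simp_all add: well_order_on_def)
  then show "wf (\<kappa> - Id)" by simp
  show "(\<xi>, \<eta>) \<in> \<kappa> \<or> (\<eta>, \<xi>) \<in> \<kappa>" if "\<xi> \<in> Field \<kappa>" "\<eta> \<in> Field \<kappa>" for \<xi> \<eta>
    using lin that unfolding linear_order_on_def partial_order_on_def preorder_on_def total_on_def refl_on_def
    by metis
  show "(\<xi>, \<zeta>) \<in> \<kappa>" if "(\<xi>, \<eta>) \<in> \<kappa>" "(\<eta>, \<zeta>) \<in> \<kappa>" for \<xi> \<eta> \<zeta>
    using lin that unfolding linear_order_on_def partial_order_on_def preorder_on_def trans_def by blast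
  show "\<xi> = \<eta>" if "(\<xi>, \<eta>) \<in> \<kappa>" "(\<eta>, \<xi>) \<in> \<kappa>" for \<xi> \<eta>
    using lin that unfolding linear_order_on_def partial_order_on_def antisym_def by blast
qed

lemma aboveS_trans:
  assumes "Card_order \<kappa>" "\<eta> \<in> aboveS \<kappa> \<xi>" "(\<eta>, \<zeta>) \<in> \<kappa>"
  shows "\<zeta> \<in> aboveS \<kappa> \<xi>"
  using assms(2,3) Card_order_trans[OF assms(1)] Card_order_antisym[OF assms(1)]
  by (auto simp: aboveS_def)

lemma aboveS_cases:
  assumes "Card_order \<kappa>" "\<xi> \<in> Field \<kappa>" "\<eta> \<in> Field \<kappa>"
  shows "\<eta> = \<xi> \<or> \<eta> \<in> aboveS \<kappa> \<xi> \<or> \<xi> \<in> aboveS \<kappa> \<eta>"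
  using Card_order_total[OF assms] by (auto simp: aboveS_def)

lemma aboveS_asym:
  assumes "Card_order \<kappa>"
  shows "\<not> (\<eta> \<in> aboveS \<kappa> \<xi> \<and> \<xi> \<in> aboveS \<kappa> \<eta>)"
  using Card_order_antisym[OF assms] by (auto simp: aboveS_def)

section \<open>Recognizing copies of the space\<close>

text \<open>A cardinal is the least order type of its size, so \<open>\<kappa>\<close> embeds into
  \<open>B\<close> with the induced order; and a strictly increasing map of a well-order into itself
  never moves a point down.\<close>

lemma exists_strictly_increasing_into:
  assumes \<kappa>: "Card_order \<kappa>" and B: "B \<subseteq> Field \<kappa>" "\<kappa> \<le>o |B|"
  shows "\<exists>e. (\<forall>\<xi>\<in>Field \<kappa>. e \<xi> \<in> B \<and> (\<xi>, e \<xi>) \<in> \<kappa>) \<and>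
             (\<forall>\<xi>\<in>Field \<kappa>. \<forall>\<eta>\<in>aboveS \<kappa> \<xi>. e \<eta> \<in> aboveS \<kappa> (e \<xi>))"
proof -
  have wo: "Well_order \<kappa>"
    using \<kappa> by (simp add: card_order_on_def)
  have woB: "well_order_on B (Restr \<kappa> B)"
    by (rule well_order_on_Restr[OF wo B(1)])
  then have FB: "Field (Restr \<kappa> B) = B"
    using well_order_on_Field by blast
  have "\<kappa> \<le>o Restr \<kappa> B"
    using card_of_least[OF woB] B(2) ordLeq_transitive by blast
  then obtain f where f: "embed \<kappa> (Restr \<kappa> B) f"
    unfolding ordLeq_def by blast
  have mono: "(f \<xi>, f \<eta>) \<in> \<kappa>" if "(\<xi>, \<eta>) \<in> \<kappa>" for \<xi> \<eta>
    using embed_compat[OF f] that unfolding compat_def by blast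
  have inj: "inj_on f (Field \<kappa>)"
    using embed_inj_on[OF wo f] .
  have fB: "f \<xi> \<in> B" if "\<xi> \<in> Field \<kappa>" for \<xi>
    using embed_Field[OF f] that FB by blast
  have "(\<xi>, f \<xi>) \<in> \<kappa>" if "\<xi> \<in> Field \<kappa>" for \<xi>
    using Card_order_wf[OF \<kappa>] that
  proof (induction \<xi> rule: wf_induct_rule)
    case (less \<xi>)
    show ?case
    proof (rule ccontr)
      assume "(\<xi>, f \<xi>) \<notin> \<kappa>"
      moreover have fF: "f \<xi> \<in> Field \<kappa>"
        using fB less.prems B(1) by blast
      ultimately have lt: "(f \<xi>, \<xi>) \<in> \<kappa>" "f \<xi> \<noteq> \<xi>"
        using Card_order_total[OF \<kappa>] less.prems by metis+
      then have "(f \<xi>, f (f \<xi>)) \<in> \<kappa>"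
        using less.IH[of "f \<xi>"] fF by simp
      moreover have "(f (f \<xi>), f \<xi>) \<in> \<kappa>"
        by (rule mono[OF lt(1)])
      ultimately have "f (f \<xi>) = f \<xi>"
        using Card_order_antisym[OF \<kappa>] by blast
      then show False
        using inj_onD[OF inj, of "f \<xi>" \<xi>] fF less.prems lt(2) by simp
    qed
  qed
  moreover have "f \<eta> \<in> aboveS \<kappa> (f \<xi>)" if "\<xi> \<in> Field \<kappa>" "\<eta> \<in> aboveS \<kappa> \<xi>" for \<xi> \<eta>
  proof -
    have "(\<xi>, \<eta>) \<in> \<kappa>" "\<eta> \<noteq> \<xi>" "\<eta> \<in> Field \<kappa>"
      using that by (auto simp: aboveS_def intro: FieldI2)
    then show ?thesis
      using mono[of \<xi> \<eta>] inj_onD[OF inj, of \<eta> \<xi>] that(1) by (auto simp: aboveS_def)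
  qed
  ultimately show ?thesis
    using fB by blast
qed

text \<open>For the evident map from \<open>P_space \<kappa>\<close>, \<open>lim\<close> gives
  continuity, \<open>iso\<close> gives injectivity and openness at the isolated points, and
  \<open>tail\<close> gives openness at the top point.\<close>

lemma homeomorphic_P_space:
  assumes \<kappa>: "Card_order \<kappa>"
    and top: "q \<in> topspace X" "\<And>\<xi>. \<xi> \<in> Field \<kappa> \<Longrightarrow> g \<xi> \<in> topspace X"
    and lim: "\<And>U. openin X U \<Longrightarrow> q \<in> U \<Longrightarrow> \<exists>\<xi>\<in>Field \<kappa>. \<forall>\<eta>\<in>aboveS \<kappa> \<xi>. g \<eta> \<in> U"
    and iso: "\<And>\<xi>. \<xi> \<in> Field \<kappa> \<Longrightarrow>
      \<exists>U. openin X U \<and> g \<xi> \<in> U \<and> q \<notin> U \<and> (\<forall>\<eta>\<in>Field \<kappa>. g \<eta> \<in> U \<longrightarrow> \<eta> = \<xi>)"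
    and tail: "\<And>\<xi>. \<xi> \<in> Field \<kappa> \<Longrightarrow>
      \<exists>U. openin X U \<and> q \<in> U \<and> (\<forall>\<eta>\<in>Field \<kappa>. g \<eta> \<in> U \<longrightarrow> \<eta> \<in> aboveS \<kappa> \<xi>)"
  shows "subtopology X (insert q (g ` Field \<kappa>)) homeomorphic_space P_space \<kappa>"
proof -
  define h where "h x = (case x of None \<Rightarrow> q | Some \<xi> \<Rightarrow> g \<xi>)" for x
  define Y where "Y = insert q (g ` Field \<kappa>)"
  have h_simps [simp]: "h None = q" "h (Some \<xi>) = g \<xi>" for \<xi>
    by (simp_all add: h_def)
  have tsP: "topspace (P_space \<kappa>) = P_points \<kappa>"
  proof
    show "topspace (P_space \<kappa>) \<subseteq> P_points \<kappa>"
      using openin_topspace[of "P_space \<kappa>"] openin_P_space[OF \<kappa>] by (auto simp: P_open_def)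
    have "openin (P_space \<kappa>) (P_points \<kappa>)"
    proof -
      \<comment> \<open>That \<open>Field \<kappa>\<close> is nonempty is read off from
        \<open>lim\<close>, applied to the whole space.\<close>
      have "\<exists>\<xi>\<in>Field \<kappa>. P_tail \<kappa> \<xi> \<subseteq> P_points \<kappa>"
        using lim[OF openin_topspace top(1)]
        by (auto simp: P_tail_def P_points_def aboveS_def intro: FieldI2)
      then show ?thesis
        by (simp add: openin_P_space[OF \<kappa>] P_open_def)
    qed
    then show "P_points \<kappa> \<subseteq> topspace (P_space \<kappa>)"
      by (rule openin_subset)
  qed
  have hY: "h ` P_points \<kappa> = Y"
    unfolding Y_def P_points_def by (force simp: image_iff)
  have YX: "Y \<subseteq> topspace X"
    using top by (auto simp: Y_def)
  have inj: "inj_on h (P_points \<kappa>)"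
  proof (rule inj_onI)
    fix x y assume "x \<in> P_points \<kappa>" "y \<in> P_points \<kappa>" "h x = h y"
    then show "x = y"
      using iso by (cases x; cases y; fastforce simp: P_points_def)
  qed
  have "homeomorphic_map (P_space \<kappa>) (subtopology X Y) h"
  proof (rule bijective_open_imp_homeomorphic_map)
    show "continuous_map (P_space \<kappa>) (subtopology X Y) h"
    proof (rule continuous_map_into_subtopology)
      have "openin (P_space \<kappa>) {x \<in> P_points \<kappa>. h x \<in> U}" if U: "openin X U" for U
        unfolding openin_P_space[OF \<kappa>] P_open_def
      proof (cases "q \<in> U")
        case True
        then obtain \<xi> where \<xi>: "\<xi> \<in> Field \<kappa>" "\<forall>\<eta>\<in>aboveS \<kappa> \<xi>. g \<eta> \<in> U"
          using lim[OF U] by blast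
        then have "P_tail \<kappa> \<xi> \<subseteq> {x \<in> P_points \<kappa>. h x \<in> U}"
          using True by (auto simp: P_tail_def P_points_def aboveS_def intro: FieldI2)
        with \<xi>(1) show "{x \<in> P_points \<kappa>. h x \<in> U} \<subseteq> P_points \<kappa> \<and>
            ({x \<in> P_points \<kappa>. h x \<in> U} \<subseteq> Some ` Field \<kappa> \<or>
             (\<exists>\<xi>\<in>Field \<kappa>. P_tail \<kappa> \<xi> \<subseteq> {x \<in> P_points \<kappa>. h x \<in> U}))"
          by blast
      next
        case False
        then have "{x \<in> P_points \<kappa>. h x \<in> U} \<subseteq> Some ` Field \<kappa>"
          by (auto simp: P_points_def)
        then show "{x \<in> P_points \<kappa>. h x \<in> U} \<subseteq> P_points \<kappa> \<and>
            ({x \<in> P_points \<kappa>. h x \<in> U} \<subseteq> Some ` Field \<kappa> \<or>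
             (\<exists>\<xi>\<in>Field \<kappa>. P_tail \<kappa> \<xi> \<subseteq> {x \<in> P_points \<kappa>. h x \<in> U}))"
          by blast
      qed
      moreover have "h \<in> P_points \<kappa> \<rightarrow> topspace X"
        using hY YX by blast
      ultimately show "continuous_map (P_space \<kappa>) X h"
        by (simp add: continuous_map_def tsP)
      show "h \<in> topspace (P_space \<kappa>) \<rightarrow> Y"
        using hY by (auto simp: tsP)
    qed
    show "open_map (P_space \<kappa>) (subtopology X Y) h"
      unfolding open_map_def openin_P_space[OF \<kappa>]
    proof (intro allI impI)
      fix V assume V: "P_open \<kappa> V"
      have "\<exists>T. openin X T \<and> h x \<in> T \<and> T \<inter> Y \<subseteq> h ` V" if x: "x \<in> V" for x
      proof (cases x)
        case None
        then obtain \<xi> where \<xi>: "\<xi> \<in> Field \<kappa>" "P_tail \<kappa> \<xi> \<subseteq> V"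
          using V x by (auto simp: P_open_def)
        obtain U where U: "openin X U" "q \<in> U" "\<forall>\<eta>\<in>Field \<kappa>. g \<eta> \<in> U \<longrightarrow> \<eta> \<in> aboveS \<kappa> \<xi>"
          using tail[OF \<xi>(1)] by (elim exE conjE)
        have "y \<in> h ` V" if "y \<in> U \<inter> Y" for y
        proof -
          have "y \<in> h ` P_tail \<kappa> \<xi>"
            using that U(3) by (force simp: Y_def P_tail_def image_iff)
          with \<xi>(2) show ?thesis by blast
        qed
        with U None show ?thesis by auto
      next
        case (Some \<xi>)
        then have \<xi>: "\<xi> \<in> Field \<kappa>"
          using V x by (auto simp: P_open_def P_points_def)
        obtain U where U: "openin X U" "g \<xi> \<in> U" "q \<notin> U" "\<forall>\<eta>\<in>Field \<kappa>. g \<eta> \<in> U \<longrightarrow> \<eta> = \<xi>"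
          using iso[OF \<xi>] by (elim exE conjE)
        have "U \<inter> Y \<subseteq> {h x}"
          using U(3,4) Some by (auto simp: Y_def)
        also have "\<dots> \<subseteq> h ` V"
          using x by blast
        finally show ?thesis
          using U(1,2) Some by (intro exI[of _ U]) simp
      qed
      then obtain T where T: "\<And>x. x \<in> V \<Longrightarrow> openin X (T x)" "\<And>x. x \<in> V \<Longrightarrow> h x \<in> T x"
        "\<And>x. x \<in> V \<Longrightarrow> T x \<inter> Y \<subseteq> h ` V"
        by metis
      have "h ` V \<subseteq> Y"
        using V hY by (auto simp: P_open_def)
      then have "h ` V = (\<Union>x\<in>V. T x) \<inter> Y"
        using T(2,3) by blast
      moreover have "openin X (\<Union>x\<in>V. T x)"
        using T(1) by blast
      ultimately show "openin (subtopology X Y) (h ` V)"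
        unfolding openin_subtopology by blast
    qed
    show "h ` topspace (P_space \<kappa>) = topspace (subtopology X Y)"
      using hY YX by (auto simp: tsP)
    show "inj_on h (topspace (P_space \<kappa>))"
      using inj by (simp add: tsP)
  qed
  then show ?thesis
    unfolding Y_def[symmetric]
    using homeomorphic_map_imp_homeomorphic_space homeomorphic_space_sym by blast
qed

text \<open>The form suited to colourings: \<open>Q\<close> will be a colour class and
  \<open>B\<close> a set of indices landing in it. The increasing map \<open>e\<close> reindexes by
  all of \<open>\<kappa>\<close>; it preserves and reflects the order and moves no index down, so
  tails correspond.\<close>

lemma P_space_copy_of_large_subset:
  assumes \<kappa>: "Card_order \<kappa>" and B: "B \<subseteq> Field \<kappa>" "\<kappa> \<le>o |B|"
    and Q: "q \<in> Q" "\<And>\<xi>. \<xi> \<in> B \<Longrightarrow> g \<xi> \<in> Q"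
    and qg: "q \<in> topspace X" "\<And>\<xi>. \<xi> \<in> B \<Longrightarrow> g \<xi> \<in> topspace X"
    and conv: "\<And>U. openin X U \<Longrightarrow> q \<in> U \<Longrightarrow> \<exists>\<xi>\<in>Field \<kappa>. \<forall>\<eta>\<in>B. \<eta> \<in> aboveS \<kappa> \<xi> \<longrightarrow> g \<eta> \<in> U"
    and iso: "\<And>\<xi>. \<xi> \<in> B \<Longrightarrow> \<exists>U. openin X U \<and> q \<notin> U \<and> (\<forall>\<eta>\<in>B. g \<eta> \<in> U \<longleftrightarrow> \<eta> = \<xi>)"
    and tail: "\<And>\<xi>. \<xi> \<in> B \<Longrightarrow>
      \<exists>U. openin X U \<and> q \<in> U \<and> (\<forall>\<eta>\<in>B. g \<eta> \<in> U \<longrightarrow> \<eta> \<in> aboveS \<kappa> \<xi>)"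
  shows "\<exists>Y'\<subseteq>Q. subtopology X Y' homeomorphic_space P_space \<kappa>"
proof -
  obtain e where e: "\<And>\<xi>. \<xi> \<in> Field \<kappa> \<Longrightarrow> e \<xi> \<in> B" "\<And>\<xi>. \<xi> \<in> Field \<kappa> \<Longrightarrow> (\<xi>, e \<xi>) \<in> \<kappa>"
    and e_mono: "\<And>\<xi> \<eta>. \<xi> \<in> Field \<kappa> \<Longrightarrow> \<eta> \<in> aboveS \<kappa> \<xi> \<Longrightarrow> e \<eta> \<in> aboveS \<kappa> (e \<xi>)"
    using exists_strictly_increasing_into[OF \<kappa> B] by blast
  have e_irrefl: "\<not> e \<xi> \<in> aboveS \<kappa> (e \<xi>)" for \<xi>
    by (simp add: aboveS_def)
  have e_inj: "\<eta> = \<xi>" if "\<xi> \<in> Field \<kappa>" "\<eta> \<in> Field \<kappa>" "e \<eta> = e \<xi>" for \<xi> \<eta>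
    using aboveS_cases[OF \<kappa> that(1,2)] e_mono that e_irrefl by metis
  have e_reflects: "\<eta> \<in> aboveS \<kappa> \<xi>" if "\<xi> \<in> Field \<kappa>" "\<eta> \<in> Field \<kappa>" "e \<eta> \<in> aboveS \<kappa> (e \<xi>)" for \<xi> \<eta>
    using aboveS_cases[OF \<kappa> that(1,2)] e_mono that e_irrefl aboveS_asym[OF \<kappa>] by metis
  have "subtopology X (insert q ((\<lambda>\<xi>. g (e \<xi>)) ` Field \<kappa>)) homeomorphic_space P_space \<kappa>"
  proof (rule homeomorphic_P_space[OF \<kappa>])
    fix U assume U: "openin X U" "q \<in> U"
    obtain \<xi> where \<xi>: "\<xi> \<in> Field \<kappa>" "\<forall>\<eta>\<in>B. \<eta> \<in> aboveS \<kappa> \<xi> \<longrightarrow> g \<eta> \<in> U"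
      using conv[OF U] by blast
    have "g (e \<eta>) \<in> U" if "\<eta> \<in> aboveS \<kappa> \<xi>" for \<eta>
    proof -
      have "\<eta> \<in> Field \<kappa>"
        using that by (auto simp: aboveS_def intro: FieldI2)
      then show ?thesis
        using \<xi>(2) e aboveS_trans[OF \<kappa> that] by blast
    qed
    with \<xi>(1) show "\<exists>\<xi>\<in>Field \<kappa>. \<forall>\<eta>\<in>aboveS \<kappa> \<xi>. g (e \<eta>) \<in> U"
      by blast
  next
    fix \<xi> assume \<xi>: "\<xi> \<in> Field \<kappa>"
    obtain U where "openin X U" "q \<notin> U" "\<forall>\<eta>\<in>B. g \<eta> \<in> U \<longleftrightarrow> \<eta> = e \<xi>"
      using iso[OF e(1)[OF \<xi>]] by blast
    then show "\<exists>U. openin X U \<and> g (e \<xi>) \<in> U \<and> q \<notin> U \<and>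
        (\<forall>\<eta>\<in>Field \<kappa>. g (e \<eta>) \<in> U \<longrightarrow> \<eta> = \<xi>)"
      using e(1) e_inj[OF \<xi>] \<xi> by (intro exI[of _ U]) simp
    obtain U where "openin X U" "q \<in> U" "\<forall>\<eta>\<in>B. g \<eta> \<in> U \<longrightarrow> \<eta> \<in> aboveS \<kappa> (e \<xi>)"
      using tail[OF e(1)[OF \<xi>]] by blast
    then show "\<exists>U. openin X U \<and> q \<in> U \<and>
        (\<forall>\<eta>\<in>Field \<kappa>. g (e \<eta>) \<in> U \<longrightarrow> \<eta> \<in> aboveS \<kappa> \<xi>)"
      using e(1) e_reflects[OF \<xi>] by (intro exI[of _ U]) simp
  qed (use qg e in auto)
  moreover have "insert q ((\<lambda>\<xi>. g (e \<xi>)) ` Field \<kappa>) \<subseteq> Q"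
    using Q e(1) by auto
  ultimately show ?thesis by blast
qed

section \<open>Small and bounded sets of ordinals\<close>

lemma ordLess_of_not_ordLeq_Card_order:
  assumes "Card_order \<kappa>" "\<not> \<kappa> \<le>o |C|"
  shows "|C| <o \<kappa>"
  using assms card_of_Well_order not_ordLeq_iff_ordLess card_order_on_well_order_on by blast

lemma ordLeq_card_of_Field_Diff:
  assumes \<kappa>: "Card_order \<kappa>" and inf: "infinite (Field \<kappa>)" and C: "C \<subseteq> Field \<kappa>" "|C| <o \<kappa>"
  shows "\<kappa> \<le>o |Field \<kappa> - C|"
proof (rule ccontr)
  assume "\<not> \<kappa> \<le>o |Field \<kappa> - C|"
  then have "|Field \<kappa> - C| <o \<kappa>"
    by (rule ordLess_of_not_ordLeq_Card_order[OF \<kappa>])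
  then have "|(Field \<kappa> - C) \<union> C| <o \<kappa>"
    using C(2) inf \<kappa> by (intro card_of_Un_ordLess_infinite_Field)
  moreover have "(Field \<kappa> - C) \<union> C = Field \<kappa>"
    using C(1) by auto
  ultimately show False
    using card_of_Field_ordIso[OF \<kappa>] not_ordLess_ordIso by metis
qed

text \<open>Removing a small set leaves a set of full size, and this does not fit into a proper
  initial segment, which is smaller than the cardinal.\<close>

lemma Field_Diff_unbounded:
  assumes \<kappa>: "Card_order \<kappa>" and inf: "infinite (Field \<kappa>)"
    and C: "C \<subseteq> Field \<kappa>" "|C| <o \<kappa>" and \<xi>: "\<xi> \<in> Field \<kappa>"
  shows "\<exists>\<eta>\<in>Field \<kappa> - C. \<eta> \<in> aboveS \<kappa> \<xi>"
proof (rule ccontr)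
  assume none: "\<not> ?thesis"
  have "Field \<kappa> - C \<subseteq> underS \<kappa> \<xi> \<union> {\<xi>}"
  proof
    fix \<eta> assume "\<eta> \<in> Field \<kappa> - C"
    then show "\<eta> \<in> underS \<kappa> \<xi> \<union> {\<xi>}"
      using none aboveS_cases[OF \<kappa> \<xi>, of \<eta>] by (auto simp: aboveS_def underS_def)
  qed
  then have "|Field \<kappa> - C| \<le>o |underS \<kappa> \<xi> \<union> {\<xi>}|"
    by (rule card_of_mono1)
  moreover have "|underS \<kappa> \<xi> \<union> {\<xi>}| <o \<kappa>"
  proof (rule card_of_Un_ordLess_infinite_Field[OF inf \<kappa>])
    show "|underS \<kappa> \<xi>| <o \<kappa>"
      by (rule card_of_underS[OF \<kappa> \<xi>])
    show "|{\<xi>}| <o \<kappa>"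
      by (rule finite_ordLess_infinite)
        (use inf \<kappa> in \<open>simp_all add: Field_card_of card_of_well_order_on card_order_on_well_order_on\<close>)
  qed
  ultimately have "|Field \<kappa> - C| <o \<kappa>"
    using ordLeq_ordLess_trans by blast
  then show False
    using ordLeq_card_of_Field_Diff[OF \<kappa> inf C] not_ordLess_ordLeq by blast
qed

text \<open>A countable set is too small to be cofinal. As \<open>cofinal\<close> asks for strict
  upper bounds, its failure gives, by totality, a weak upper bound of \<open>B\<close>.\<close>

lemma countable_bounded_of_cofinality:
  assumes \<kappa>: "Card_order \<kappa>" "natLeq <o cofinality \<kappa>" and B: "countable B" "B \<subseteq> Field \<kappa>"
  shows "\<exists>\<zeta>\<in>Field \<kappa>. \<forall>\<xi>\<in>B. (\<xi>, \<zeta>) \<in> \<kappa>"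
proof -
  have "\<not> cofinal B \<kappa>"
  proof
    assume "cofinal B \<kappa>"
    then have "cofinality \<kappa> \<le>o |B|"
      by (rule cofinality_least(2)[OF B(2)])
    moreover have "|B| \<le>o natLeq"
    proof -
      obtain f :: "'a \<Rightarrow> nat" where "inj_on f B"
        using B(1) by (rule countableE)
      then have "|B| \<le>o |UNIV :: nat set|"
        by (intro card_of_ordLeqI) auto
      then show ?thesis
        using card_of_nat ordLeq_ordIso_trans by blast
    qed
    ultimately show False
      using \<kappa>(2) not_ordLess_ordLeq ordLeq_transitive by blast
  qed
  then obtain \<zeta> where "\<zeta> \<in> Field \<kappa>" "\<And>\<xi>. \<xi> \<in> B \<Longrightarrow> \<not> (\<zeta> \<noteq> \<xi> \<and> (\<zeta>, \<xi>) \<in> \<kappa>)"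
    unfolding cofinal_def by blast
  then show ?thesis
    using Card_order_total[OF \<kappa>(1)] B(2) by (metis subsetD)
qed

section \<open>The square inside the remainder\<close>

text \<open>Basic neighbourhoods in \<open>P_space \<kappa>\<close>: a point
  \<open>Some \<eta>\<close> is isolated, while \<open>None\<close> has the tails.\<close>

definition P_near :: "'k rel \<Rightarrow> 'k \<Rightarrow> 'k option \<Rightarrow> 'k option \<Rightarrow> bool" where
  "P_near \<kappa> \<xi> a a' \<longleftrightarrow> a' = a \<or> (a = None \<and> a' \<in> P_tail \<kappa> \<xi>)"

text \<open>The open sets that cut out single values and tails in either factor make the inverse of
  \<open>v\<close> continuous; the last clause is continuity of \<open>v\<close>, with one
  \<open>\<xi>\<close> bounding both factors.\<close>

definition P_square_embedding ::
  "'k rel \<Rightarrow> 'a topology \<Rightarrow> ('k option \<Rightarrow> 'k option \<Rightarrow> 'a) \<Rightarrow> bool" where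
  "P_square_embedding \<kappa> X v \<longleftrightarrow>
    (\<forall>a b. v a b \<in> topspace X) \<and>
    (\<forall>\<xi>\<in>Field \<kappa>.
      (\<exists>U. openin X U \<and> (\<forall>a b. v a b \<in> U \<longleftrightarrow> a = Some \<xi>)) \<and>
      (\<exists>U. openin X U \<and> (\<forall>a b. v a b \<in> U \<longleftrightarrow> b = Some \<xi>)) \<and>
      (\<exists>U. openin X U \<and> (\<forall>a b. v a b \<in> U \<longleftrightarrow> a \<in> P_tail \<kappa> \<xi>)) \<and>
      (\<exists>U. openin X U \<and> (\<forall>a b. v a b \<in> U \<longleftrightarrow> b \<in> P_tail \<kappa> \<xi>))) \<and>
    (\<forall>U a b. openin X U \<longrightarrow> v a b \<in> U \<longrightarrow>
      (\<exists>\<xi>\<in>Field \<kappa>. \<forall>a' b'. P_near \<kappa> \<xi> a a' \<longrightarrow> P_near \<kappa> \<xi> b b' \<longrightarrow> v a' b' \<in> U))"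

text \<open>Send \<open>(a, b)\<close> to the point of the cube recording its memberships in the
  subbasic sets of the square, then apply the ultrafilter map. Countably many coordinates test
  countably many ordinals; uncountable cofinality bounds these by some \<open>\<zeta>\<close>, and
  replacing \<open>None\<close> by a point beyond \<open>\<zeta>\<close> changes none of the
  tests.\<close>

lemma exists_P_square_embedding:
  fixes \<kappa> :: "'k rel"
  assumes \<kappa>: "Card_order \<kappa>" "\<kappa> \<le>o ctwo ^c natLeq" "natLeq <o cofinality \<kappa>"
  shows "\<exists>v. P_square_embedding \<kappa> omega_star v"
proof -
  have "|Field \<kappa>| \<le>o |Func (UNIV :: nat set) (UNIV :: bool set)|"
    using ordIso_ordLeq_trans[OF card_of_Field_ordIso[OF \<kappa>(1)] \<kappa>(2)]
    by (simp add: cexp_def ctwo_def Field_natLeq Field_card_of)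
  then obtain j :: "'k \<Rightarrow> nat \<Rightarrow> bool" where j: "inj_on j (Field \<kappa>)"
    unfolding card_of_ordLeq[symmetric] by blast
  obtain \<phi>0 :: "nat \<Rightarrow> (nat \<Rightarrow> bool) \<Rightarrow> bool" where \<phi>0: "dense_along \<phi>0 sequentially"
    using exists_independent_family by blast
  \<comment> \<open>Two leading bits are split off the index sequences, so that each ordinal gets
    four coordinates.\<close>
  define h :: "(nat \<Rightarrow> bool) \<times> bool \<times> bool \<Rightarrow> nat \<Rightarrow> bool"
    where "h = (\<lambda>(f, c, d). case_nat c (case_nat d f))"
  have "inj h"
  proof (rule injI)
    fix x y assume eq: "h x = h y"
    obtain f c d f' c' d' where xy: "x = (f, c, d)" "y = (f', c', d')"
      by (metis prod_cases3)
    have "c = c'"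
      using fun_cong[OF eq, of 0] by (simp add: xy h_def)
    moreover have "d = d'"
      using fun_cong[OF eq, of "Suc 0"] by (simp add: xy h_def)
    moreover have "f n = f' n" for n
      using fun_cong[OF eq, of "Suc (Suc n)"] by (simp add: xy h_def)
    ultimately show "x = y"
      by (auto simp: xy)
  qed
  define \<phi> where "\<phi> n i = \<phi>0 n (h i)" for n i
  have "dense_along \<phi> sequentially"
    unfolding \<phi>_def by (rule dense_along_reindex[OF \<phi>0 \<open>inj h\<close>])
  then obtain u where u: "\<And>z. ultra (u z)" "\<And>z. u z \<le> sequentially" "\<And>z i. \<forall>\<^sub>F n in u z. \<phi> n i = z i"
    and supp: "\<And>P. \<exists>J. countable J \<and> (\<forall>z z'. agree_on J z z' \<longrightarrow> eventually P (u z) \<longrightarrow> eventually P (u z'))"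
    using exists_continuous_ultrafilters[of \<phi> sequentially] by blast
  \<comment> \<open>\<open>c\<close> selects one of the two factors; \<open>d\<close> selects the test \<open>= \<xi>\<close> or the test \<open>> \<xi>\<close>.\<close>
  define z where "z a b = (\<lambda>(f, c, d). \<exists>\<xi>\<in>Field \<kappa>. f = j \<xi> \<and>
      (if d then (if c then a else b) = Some \<xi> else (if c then a else b) \<in> P_tail \<kappa> \<xi>))" for a b
  define v where "v a b = ultra_point (u (z a b))" for a b
  have v_top: "v a b \<in> topspace omega_star" for a b
    unfolding v_def by (rule ultra_point_in_omega_star[OF u(1,2)])
  \<comment> \<open>\<open>u (z a b)\<close> contains the set of \<open>n\<close> with
    \<open>\<phi> n i = z a b i\<close>, so the open set of the indicator of
    \<open>\<phi> n i\<close> reads off coordinate \<open>i\<close>.\<close>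
  have sub: "\<exists>U. openin omega_star U \<and> (\<forall>a b. v a b \<in> U \<longleftrightarrow> z a b i)" for i
  proof (intro exI conjI allI)
    show "openin omega_star {x \<in> topspace omega_star. x (char_fun (\<lambda>n. \<phi> n i)) > 1/2}"
      by (rule openin_omega_star_char_fun)
    fix a b
    have "eventually (\<lambda>n. \<phi> n i) (u (z a b)) \<longleftrightarrow> z a b i"
    proof -
      have "eventually (\<lambda>n. \<phi> n i) (u (z a b)) \<longleftrightarrow> eventually (\<lambda>n. z a b i) (u (z a b))"
        by (rule eventually_subst[OF u(3)])
      then show ?thesis
        using u(1)[of "z a b"] by (simp add: ultra_def eventually_const)
    qed
    then show "v a b \<in> {x \<in> topspace omega_star. x (char_fun (\<lambda>n. \<phi> n i)) > 1/2} \<longleftrightarrow> z a b i"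
      using v_top[of a b] by (simp add: v_def ultra_point_char_fun[OF u(1)])
  qed
  have z_j: "z a b (j \<xi>, c, d) \<longleftrightarrow>
      (if d then (if c then a else b) = Some \<xi> else (if c then a else b) \<in> P_tail \<kappa> \<xi>)"
    if "\<xi> \<in> Field \<kappa>" for a b \<xi> c d
    using j that by (auto simp: z_def inj_on_eq_iff)
  have lim: "\<exists>\<xi>\<in>Field \<kappa>. \<forall>a' b'. P_near \<kappa> \<xi> a a' \<longrightarrow> P_near \<kappa> \<xi> b b' \<longrightarrow> v a' b' \<in> U"
    if U: "openin omega_star U" "v a b \<in> U" for U a b
  proof -
    obtain J where J: "countable J" "\<And>z'. agree_on J (z a b) z' \<Longrightarrow> ultra_point (u z') \<in> U"
      using ultra_point_neighbourhood[OF u(1,2) supp U(1)] U(2) unfolding v_def by blast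
    \<comment> \<open>The ordinals tested by coordinates in \<open>J\<close>.\<close>
    define K where "K = {\<xi>\<in>Field \<kappa>. j \<xi> \<in> fst ` J}"
    have "countable (j ` K)"
      by (rule countable_subset[of _ "fst ` J"]) (use J(1) in \<open>auto simp: K_def\<close>)
    then have "countable K"
      using j by (auto simp: K_def intro: countable_image_inj_on inj_on_subset)
    then obtain \<zeta> where \<zeta>: "\<zeta> \<in> Field \<kappa>" "\<And>\<xi>. \<xi> \<in> K \<Longrightarrow> (\<xi>, \<zeta>) \<in> \<kappa>"
      using countable_bounded_of_cofinality[OF \<kappa>(1,3), of K] by (auto simp: K_def)
    have near: "(a' = Some \<xi> \<longleftrightarrow> a = Some \<xi>) \<and> (a' \<in> P_tail \<kappa> \<xi> \<longleftrightarrow> a \<in> P_tail \<kappa> \<xi>)"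
      if "\<xi> \<in> K" "P_near \<kappa> \<zeta> a a'" for a a' \<xi>
    proof (cases "a' = a")
      case False
      then have a: "a = None" "a' \<in> P_tail \<kappa> \<zeta>"
        using that(2) by (auto simp: P_near_def)
      have "a' \<noteq> Some \<xi>" "a' \<in> P_tail \<kappa> \<xi>"
        using a(2) \<zeta>(2)[OF that(1)] Card_order_antisym[OF \<kappa>(1)] Card_order_trans[OF \<kappa>(1)]
        by (auto simp: P_tail_def aboveS_def)
      with a(1) show ?thesis
        by (simp add: P_tail_def)
    qed simp
    have "v a' b' \<in> U" if nab: "P_near \<kappa> \<zeta> a a'" "P_near \<kappa> \<zeta> b b'" for a' b'
      unfolding v_def
    proof (rule J(2), rule agree_onI)
      fix i assume i: "i \<in> J"
      obtain f c d where i_eq: "i = (f, c, d)"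
        by (metis prod_cases3)
      show "z a b i = z a' b' i"
      proof (cases "\<exists>\<xi>\<in>Field \<kappa>. f = j \<xi>")
        case True
        then obtain \<xi> where \<xi>: "\<xi> \<in> Field \<kappa>" "f = j \<xi>"
          by blast
        then have "\<xi> \<in> K"
          using i i_eq by (force simp: K_def)
        then show ?thesis
          using near[OF _ nab(1)] near[OF _ nab(2)] \<xi> by (simp add: i_eq z_j)
      next
        \<comment> \<open>A coordinate whose sequence codes no ordinal is false at every point of
          the square.\<close>
        case False
        then show ?thesis
          by (auto simp: z_def i_eq)
      qed
    qed
    with \<zeta>(1) show ?thesis by blast
  qed
  show ?thesis
    unfolding P_square_embedding_def
  proof (rule exI[of _ v], intro conjI ballI)
    fix \<xi> assume \<xi>: "\<xi> \<in> Field \<kappa>"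
    show "\<exists>U. openin omega_star U \<and> (\<forall>a b. v a b \<in> U \<longleftrightarrow> a = Some \<xi>)"
      using sub[of "(j \<xi>, True, True)"] by (simp add: z_j[OF \<xi>])
    show "\<exists>U. openin omega_star U \<and> (\<forall>a b. v a b \<in> U \<longleftrightarrow> b = Some \<xi>)"
      using sub[of "(j \<xi>, False, True)"] by (simp add: z_j[OF \<xi>])
    show "\<exists>U. openin omega_star U \<and> (\<forall>a b. v a b \<in> U \<longleftrightarrow> a \<in> P_tail \<kappa> \<xi>)"
      using sub[of "(j \<xi>, True, False)"] by (simp add: z_j[OF \<xi>])
    show "\<exists>U. openin omega_star U \<and> (\<forall>a b. v a b \<in> U \<longleftrightarrow> b \<in> P_tail \<kappa> \<xi>)"
      using sub[of "(j \<xi>, False, False)"] by (simp add: z_j[OF \<xi>])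
  qed (use v_top lim in blast)+
qed

section \<open>The partition argument on the square\<close>

lemma top_arrow_of_P_square_embedding:
  assumes \<kappa>: "Card_order \<kappa>" and inf: "infinite (Field \<kappa>)" and v: "P_square_embedding \<kappa> X v"
  shows "top_arrow X (P_space \<kappa>)"
proof -
  have top: "v a b \<in> topspace X" for a b
    using v by (simp add: P_square_embedding_def)
  have fst_eq: "\<exists>U. openin X U \<and> (\<forall>a b. v a b \<in> U \<longleftrightarrow> a = Some \<xi>)"
    and snd_eq: "\<exists>U. openin X U \<and> (\<forall>a b. v a b \<in> U \<longleftrightarrow> b = Some \<xi>)"
    and fst_tail: "\<exists>U. openin X U \<and> (\<forall>a b. v a b \<in> U \<longleftrightarrow> a \<in> P_tail \<kappa> \<xi>)"
    and snd_tail: "\<exists>U. openin X U \<and> (\<forall>a b. v a b \<in> U \<longleftrightarrow> b \<in> P_tail \<kappa> \<xi>)"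
    if "\<xi> \<in> Field \<kappa>" for \<xi>
    using v that unfolding P_square_embedding_def by simp_all
  have lim: "\<exists>\<xi>\<in>Field \<kappa>. \<forall>a' b'. P_near \<kappa> \<xi> a a' \<longrightarrow> P_near \<kappa> \<xi> b b' \<longrightarrow> v a' b' \<in> U"
    if "openin X U" "v a b \<in> U" for U a b
    using v that unfolding P_square_embedding_def by simp
  have tail_iff: "Some \<eta> \<in> P_tail \<kappa> \<xi> \<longleftrightarrow> \<eta> \<in> aboveS \<kappa> \<xi>" "None \<in> P_tail \<kappa> \<xi>" for \<xi> \<eta>
    by (auto simp: P_tail_def)
  have near: "P_near \<kappa> \<xi> a a" "\<eta> \<in> aboveS \<kappa> \<xi> \<Longrightarrow> P_near \<kappa> \<xi> None (Some \<eta>)" for \<xi> \<eta> a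
    by (simp_all add: P_near_def tail_iff)
  \<comment> \<open>\<open>P\<close> is whichever class contains the corner; exchanging
    \<open>P\<close> and \<open>Q\<close> covers both colours.\<close>
  have colour: "\<exists>Y'. (Y' \<subseteq> P \<or> Y' \<subseteq> Q) \<and> subtopology X Y' homeomorphic_space P_space \<kappa>"
    if PQ: "topspace X = P \<union> Q" and p: "v None None \<in> P" for P Q
  proof -
    define B where "B = {\<xi>\<in>Field \<kappa>. v (Some \<xi>) None \<in> P}"
    show ?thesis
    proof (cases "\<kappa> \<le>o |B|")
      case True
      have "\<exists>Y'\<subseteq>P. subtopology X Y' homeomorphic_space P_space \<kappa>"
      proof (rule P_space_copy_of_large_subset[OF \<kappa> _ True, where q = "v None None" and g = "\<lambda>\<xi>. v (Some \<xi>) None"])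
        fix U assume "openin X U" "v None None \<in> U"
        from lim[OF this] show "\<exists>\<xi>\<in>Field \<kappa>. \<forall>\<eta>\<in>B. \<eta> \<in> aboveS \<kappa> \<xi> \<longrightarrow> v (Some \<eta>) None \<in> U"
          using near by blast
      next
        fix \<xi> assume "\<xi> \<in> B"
        then have \<xi>: "\<xi> \<in> Field \<kappa>" by (simp add: B_def)
        from fst_eq[OF \<xi>] show "\<exists>U. openin X U \<and> v None None \<notin> U \<and> (\<forall>\<eta>\<in>B. v (Some \<eta>) None \<in> U \<longleftrightarrow> \<eta> = \<xi>)"
          by auto
        from fst_tail[OF \<xi>] show "\<exists>U. openin X U \<and> v None None \<in> U \<and> (\<forall>\<eta>\<in>B. v (Some \<eta>) None \<in> U \<longrightarrow> \<eta> \<in> aboveS \<kappa> \<xi>)"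
          by (auto simp: tail_iff)
      qed (use p top in \<open>auto simp: B_def\<close>)
      then show ?thesis by blast
    next
      case False
      have B: "B \<subseteq> Field \<kappa>" "|B| <o \<kappa>"
        using ordLess_of_not_ordLeq_Card_order[OF \<kappa> False] by (auto simp: B_def)
      \<comment> \<open>For \<open>\<xi>\<close> outside \<open>B\<close> the limit point
        \<open>v (Some \<xi>) None\<close> of the column lies in \<open>Q\<close>, so
        \<open>\<kappa>\<close> many points of \<open>Q\<close> in that column complete a
        copy.\<close>
      define C where "C \<xi> = {\<eta>\<in>Field \<kappa>. v (Some \<xi>) (Some \<eta>) \<in> Q}" for \<xi>
      show ?thesis
      proof (cases "\<exists>\<xi>\<in>Field \<kappa> - B. \<kappa> \<le>o |C \<xi>|")
        case True
        then obtain \<xi> where \<xi>: "\<xi> \<in> Field \<kappa>" "\<xi> \<notin> B" and C: "\<kappa> \<le>o |C \<xi>|"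
          by blast
        have "v (Some \<xi>) None \<in> Q"
          using \<xi> PQ top by (auto simp: B_def)
        have "\<exists>Y'\<subseteq>Q. subtopology X Y' homeomorphic_space P_space \<kappa>"
        proof (rule P_space_copy_of_large_subset[OF \<kappa> _ C, where q = "v (Some \<xi>) None" and g = "\<lambda>\<eta>. v (Some \<xi>) (Some \<eta>)"])
          fix U assume "openin X U" "v (Some \<xi>) None \<in> U"
          from lim[OF this] show "\<exists>\<zeta>\<in>Field \<kappa>. \<forall>\<eta>\<in>C \<xi>. \<eta> \<in> aboveS \<kappa> \<zeta> \<longrightarrow> v (Some \<xi>) (Some \<eta>) \<in> U"
            using near by blast
        next
          fix \<zeta> assume "\<zeta> \<in> C \<xi>"
          then have \<zeta>: "\<zeta> \<in> Field \<kappa>" by (simp add: C_def)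
          from snd_eq[OF \<zeta>] show "\<exists>U. openin X U \<and> v (Some \<xi>) None \<notin> U \<and>
              (\<forall>\<eta>\<in>C \<xi>. v (Some \<xi>) (Some \<eta>) \<in> U \<longleftrightarrow> \<eta> = \<zeta>)"
            by auto
          from snd_tail[OF \<zeta>] show "\<exists>U. openin X U \<and> v (Some \<xi>) None \<in> U \<and>
              (\<forall>\<eta>\<in>C \<xi>. v (Some \<xi>) (Some \<eta>) \<in> U \<longrightarrow> \<eta> \<in> aboveS \<kappa> \<zeta>)"
            by (auto simp: tail_iff)
        qed (use \<open>v (Some \<xi>) None \<in> Q\<close> top in \<open>auto simp: C_def\<close>)
        then show ?thesis by blast
      next
        case False
        have "\<exists>\<eta>. \<eta> \<in> aboveS \<kappa> \<xi> \<and> v (Some \<xi>) (Some \<eta>) \<in> P" if \<xi>: "\<xi> \<in> Field \<kappa> - B" for \<xi>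
        proof -
          have "|C \<xi>| <o \<kappa>"
            using False that by (intro ordLess_of_not_ordLeq_Card_order[OF \<kappa>]) blast
          then obtain \<eta> where "\<eta> \<in> Field \<kappa> - C \<xi>" "\<eta> \<in> aboveS \<kappa> \<xi>"
            using Field_Diff_unbounded[OF \<kappa> inf, of "C \<xi>" \<xi>] \<xi> unfolding C_def by blast
          then show ?thesis
            using PQ top by (auto simp: C_def)
        qed
        \<comment> \<open>Choosing \<open>f \<xi>\<close> above \<open>\<xi>\<close> makes both
          coordinates pass any given \<open>\<zeta>\<close> together, so these points approach the
          corner; their first coordinates alone separate them.\<close>
        then obtain f where f: "\<And>\<xi>. \<xi> \<in> Field \<kappa> - B \<Longrightarrow> f \<xi> \<in> aboveS \<kappa> \<xi>"
          "\<And>\<xi>. \<xi> \<in> Field \<kappa> - B \<Longrightarrow> v (Some \<xi>) (Some (f \<xi>)) \<in> P"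
          by metis
        have "\<exists>Y'\<subseteq>P. subtopology X Y' homeomorphic_space P_space \<kappa>"
        proof (rule P_space_copy_of_large_subset[OF \<kappa> _ ordLeq_card_of_Field_Diff[OF \<kappa> inf B], where q = "v None None" and g = "\<lambda>\<xi>. v (Some \<xi>) (Some (f \<xi>))"])
          fix U assume "openin X U" "v None None \<in> U"
          then obtain \<zeta> where \<zeta>: "\<zeta> \<in> Field \<kappa>"
            "\<And>a' b'. P_near \<kappa> \<zeta> None a' \<Longrightarrow> P_near \<kappa> \<zeta> None b' \<Longrightarrow> v a' b' \<in> U"
            using lim by blast
          have "v (Some \<eta>) (Some (f \<eta>)) \<in> U" if "\<eta> \<in> Field \<kappa> - B" "\<eta> \<in> aboveS \<kappa> \<zeta>" for \<eta>
          proof -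
            have "f \<eta> \<in> aboveS \<kappa> \<zeta>"
              using f(1)[OF that(1)] aboveS_trans[OF \<kappa> that(2)] by (auto simp: aboveS_def)
            with that(2) show ?thesis
              by (intro \<zeta>(2) near(2))
          qed
          with \<zeta>(1) show "\<exists>\<xi>\<in>Field \<kappa>. \<forall>\<eta>\<in>Field \<kappa> - B. \<eta> \<in> aboveS \<kappa> \<xi> \<longrightarrow> v (Some \<eta>) (Some (f \<eta>)) \<in> U"
            by blast
        next
          fix \<xi> assume "\<xi> \<in> Field \<kappa> - B"
          then have \<xi>: "\<xi> \<in> Field \<kappa>" by simp
          from fst_eq[OF \<xi>] show "\<exists>U. openin X U \<and> v None None \<notin> U \<and>
              (\<forall>\<eta>\<in>Field \<kappa> - B. v (Some \<eta>) (Some (f \<eta>)) \<in> U \<longleftrightarrow> \<eta> = \<xi>)"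
            by auto
          from fst_tail[OF \<xi>] show "\<exists>U. openin X U \<and> v None None \<in> U \<and>
              (\<forall>\<eta>\<in>Field \<kappa> - B. v (Some \<eta>) (Some (f \<eta>)) \<in> U \<longrightarrow> \<eta> \<in> aboveS \<kappa> \<xi>)"
            by (auto simp: tail_iff)
        qed (use p top f(2) in auto)
        then show ?thesis by blast
      qed
    qed
  qed
  show ?thesis
    unfolding top_arrow_def
  proof (intro allI impI)
    fix P :: "nat \<Rightarrow> 'b set"
    assume P: "topspace X = P 0 \<union> P 1"
    then have "v None None \<in> P 0 \<or> v None None \<in> P 1"
      using top by blast
    then obtain Y' where "Y' \<subseteq> P 0 \<or> Y' \<subseteq> P 1" "subtopology X Y' homeomorphic_space P_space \<kappa>"
      using colour[of "P 0" "P 1"] colour[of "P 1" "P 0"] P Un_commute[of "P 0" "P 1"] by metis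
    then show "\<exists>i\<in>{0, 1}. \<exists>Y'\<subseteq>P i. subtopology X Y' homeomorphic_space P_space \<kappa>"
      by blast
  qed
qed
theorem theorem4p3:
  fixes \<kappa> :: "'k rel"
  assumes "Card_order \<kappa>"
    and "cardSuc natLeq \<le>o \<kappa>"
    and "\<kappa> \<le>o ctwo ^c natLeq"
    and "natLeq <o cofinality \<kappa>"
  shows "top_arrow omega_star (P_space \<kappa>)"
proof -
  have inf: "infinite (Field \<kappa>)"
  proof -
    have "natLeq \<le>o \<kappa>"
      using cardSuc_ordLeq[OF natLeq_Card_order] assms(2) ordLeq_transitive by blast
    then show ?thesis
      using assms(1) cinfinite_mono natLeq_cinfinite cinfinite_def by blast
  qed
  obtain v where "P_square_embedding \<kappa> omega_star v"
    using exists_P_square_embedding[OF assms(1,3,4)] by blast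
  then show ?thesis
    by (rule top_arrow_of_P_square_embedding[OF assms(1) inf])
qed

end
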